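(* The abelianization $B_\omega/(B_\omega)'$ of the $\omega$-braid group $B_\omega$ is complete modulo the Ulm subgroup.
   Context: $\omega=\{0,1,2,\dots\}\subset\mathbb{C}$ is the set of non-negative integers. Let $\mathbb{I}=[0,1]$. $\mathbb{C}^\omega$ is the product space (product topology) and $F_\omega=\{u\in\mathbb{C}^\omega : u(x)\neq u(y)\text{ for all distinct }x,y\in\omega\}$ with the subspace topology. A path in a space is a continuous map from $\mathbb{I}$; $f\cdot g$ denotes concatenation of paths (first $f$, then $g$); $f\sim g$ means homotopic relative to $\{0,1\}$. $\Sigma_\omega$ is the set of all permutations of $\omega$, regarded as a subset of $F_\omega$. For a path $f$ in $F_\omega$ and $\sigma\in\Sigma_\omega$, $f^\sigma(t)(x)=f(t)(\sigma(x))$. An $\omega$-braid is a path $f:\mathbb{I}\to F_\omega$ with $f(0)=\mathrm{id}_\omega$ and $f(1)\in\Sigma_\omega$. $B_\omega$ is the set of $\sim$-classes $[f]$ of $\omega$-braids, a group under $[f][g]=[f\cdot g^{f(1)}]$. $G'$ denotes the commutator subgroup of a group $G$. An abelian group $A$ is called complete modulo the Ulm subgroup (complete mod-$U$) if for any sequence $x_n\in A$ ($0<n\in\omega$) with $n!\mid x_{n+1}-x_n$ for all $n>0$, there exists $x\in A$ such that $n!\mid x-x_n$ for all $n>0$. (Here $k\mid a$ means $a\in kA$.) *)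

theory Defs
  imports "HOL-Analysis.Analysis" "HOL-Algebra.Generated_Groups"
begin

section \<open>The \<open>\<omega>\<close>-braid group\<close>

text \<open>
  The set \<open>\<omega>\<close> is rendered by the type \<^typ>\<open>nat\<close>, and its inclusion into the complex plane by
  \<^term>\<open>of_nat :: nat \<Rightarrow> complex\<close>. The topology on \<^typ>\<open>nat \<Rightarrow> complex\<close> is the product topology
  from \<open>HOL-Analysis.Function_Topology\<close>.
\<close>

definition F_omega :: "(nat \<Rightarrow> complex) set" where
  "F_omega = {u. \<forall>x y. x \<noteq> y \<longrightarrow> u x \<noteq> u y}"

definition Sigma_omega :: "(nat \<Rightarrow> complex) set" where
  "Sigma_omega = {(\<lambda>x. of_nat (\<pi> x)) |\<pi>. bij \<pi>}"

text \<open>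
  An element of \<^const>\<open>Sigma_omega\<close> is read back as a permutation of \<^typ>\<open>nat\<close>; elsewhere the
  value is irrelevant.
\<close>

definition perm_of :: "(nat \<Rightarrow> complex) \<Rightarrow> nat \<Rightarrow> nat" where
  "perm_of u = (THE \<pi>. bij \<pi> \<and> u = (\<lambda>x. of_nat (\<pi> x)))"

definition path_act :: "(real \<Rightarrow> nat \<Rightarrow> complex) \<Rightarrow> (nat \<Rightarrow> complex) \<Rightarrow> real \<Rightarrow> nat \<Rightarrow> complex" where
  "path_act f \<sigma> = (\<lambda>t x. f t (perm_of \<sigma> x))"

definition omega_braids :: "(real \<Rightarrow> nat \<Rightarrow> complex) set" where
  "omega_braids =
     {f. path f \<and> path_image f \<subseteq> F_omega \<and> pathstart f = of_nat \<and> pathfinish f \<in> Sigma_omega}"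

text \<open>
  Paths in HOL-Analysis are functions on all of \<^typ>\<open>real\<close>; \<^const>\<open>homotopic_paths\<close> only depends
  on their restrictions to the unit interval, so values outside it do not affect the classes.
\<close>

definition braid_class :: "(real \<Rightarrow> nat \<Rightarrow> complex) \<Rightarrow> (real \<Rightarrow> nat \<Rightarrow> complex) set" where
  "braid_class f = {g \<in> omega_braids. homotopic_paths F_omega f g}"

text \<open>
  The product is the union of the classes \<open>[f \<cdot> g\<^sup>f\<^sup>(\<^sup>1\<^sup>)]\<close> over all representatives \<open>f\<close>, \<open>g\<close>;
  these classes all coincide, so it is the class of any one of them.
\<close>

definition braid_group :: "(real \<Rightarrow> nat \<Rightarrow> complex) set monoid" where
  "braid_group =
     \<lparr>carrier = braid_class ` omega_braids,
      mult = (\<lambda>X Y. \<Union>f\<in>X. \<Union>g\<in>Y. braid_class (f +++ path_act g (pathfinish f))),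
      one = braid_class (\<lambda>_. of_nat)\<rparr>"


section \<open>Completeness modulo the Ulm subgroup\<close>

text \<open>
  Groups of HOL-Algebra are written multiplicatively: \<open>k \<bar> a\<close> means that \<open>a\<close> is a \<open>k\<close>-th power,
  and \<open>a - b\<close> becomes \<open>a \<otimes> inv b\<close>.
\<close>

definition nat_divides :: "('a, 'b) monoid_scheme \<Rightarrow> nat \<Rightarrow> 'a \<Rightarrow> bool" where
  "nat_divides A k a \<longleftrightarrow> (\<exists>b\<in>carrier A. a = b [^]\<^bsub>A\<^esub> k)"

definition complete_mod_Ulm :: "('a, 'b) monoid_scheme \<Rightarrow> bool" where
  "complete_mod_Ulm A \<longleftrightarrow> comm_group A \<and>
     (\<forall>x :: nat \<Rightarrow> 'a.
        (\<forall>n>0. x n \<in> carrier A) \<and>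
        (\<forall>n>0. nat_divides A (fact n) (x (n + 1) \<otimes>\<^bsub>A\<^esub> inv\<^bsub>A\<^esub> (x n))) \<longrightarrow>
        (\<exists>y\<in>carrier A. \<forall>n>0. nat_divides A (fact n) (y \<otimes>\<^bsub>A\<^esub> inv\<^bsub>A\<^esub> (x n))))"

end

theory Submission
  imports Defs
begin

text \<open>
  Write \<open>B\<close> for the braid group and \<open>B'\<close> for its commutator subgroup. Completeness modulo the Ulm
  subgroup asks to sum series \<open>x\<^sub>1 + b\<^sub>1 + 2! b\<^sub>2 + 3! b\<^sub>3 + \<dots>\<close> in \<open>B/B'\<close>. It suffices to solve, for any sequence
  \<open>b\<^sub>1, b\<^sub>2, \<dots>\<close>, the infinite system \<open>y\<^sub>n = b\<^sub>n + (n + 1) y\<^sub>n\<^sub>+\<^sub>1\<close>: the sum is then \<open>x\<^sub>1 + y\<^sub>1\<close>, and its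
  difference to \<open>x\<^sub>n\<close> is \<open>n! y\<^sub>n\<close> (\<open>complete_mod_UlmI\<close>).

  The topology solves the system. Suppose that \<open>b\<^sub>n\<close> is the class of a loop \<open>\<beta>\<^sub>n\<close> that keeps the first \<open>n\<close>
  strands constant. The infinitely nested concatenation \<open>Y\<^sub>n = \<beta>\<^sub>n \<cdot> Y\<^sub>n\<^sub>+\<^sub>1 \<cdot> \<dots> \<cdot> Y\<^sub>n\<^sub>+\<^sub>1\<close>, with \<open>n + 1\<close> factors
  \<open>Y\<^sub>n\<^sub>+\<^sub>1\<close>, then makes sense: a single strand, or a pair of strands, sees only finitely many of the \<open>\<beta>\<^sub>k\<close>
  move, and continuity in the product topology and the absence of collisions are conditions on single
  strands and on pairs of strands (\<open>nested_braid_exists\<close>).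

  So the point is that, for every \<open>n\<close>, each element of \<open>B/B'\<close> is the class of a loop whose first \<open>n\<close>
  strands are constant (\<open>class_represented_by_pure_braid_fixing_first_strands\<close>). This takes three steps.

  \<^item> The permutation of a braid can be changed at will inside \<open>B'\<close>, because every permutation of the
    natural numbers is a product of commutators (\<open>perm_commutator_induct\<close>,
    \<open>derived_surj_on_perms\<close>). This leaves a loop \<open>f\<close>.

  \<^item> Some loop \<open>d\<close> with class in \<open>B'\<close> moves the first \<open>n\<close> strands as \<open>f\<close> does, up to homotopy
    (\<open>first_strands_realized_in_derived\<close>). The first \<open>n\<close> strands of \<open>f\<close> stay in a bounded region, so
    infinitely many copies of their motion fit side by side, indexed by the integers. Performing all
    copies with index \<open>\<ge> 0\<close> and performing all copies with index \<open>\<ge> 1\<close> are conjugate by a translation,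
    and their quotient is the single copy with index \<open>0\<close>.

  \<^item> Now the first \<open>n\<close> strands of \<open>f \<cdot> d\<^sup>-\<^sup>1\<close> are null-homotopic. Such a homotopy of finitely many strands
    extends to all strands, which are pushed out of the way
    (\<open>lift_homotopy_of_first_strands\<close>); at its end the first \<open>n\<close> strands are constant.
\<close>

section \<open>Homotopies of paths in arbitrary spaces\<close>

text \<open>
  Configuration spaces carry no linear structure, so the linear homotopies that drive the
  fundamental groupoid in normed spaces have to be carried out in a convex parameter domain and
  pushed forward.
\<close>

lemma homotopic_paths_convex_image:
  fixes p q :: "real \<Rightarrow> 'a::real_normed_vector" and \<Phi> :: "'a \<Rightarrow> 'b::topological_space"
  assumes "convex S" "path p" "path q" "path_image p \<subseteq> S" "path_image q \<subseteq> S"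
    and "pathstart q = pathstart p" "pathfinish q = pathfinish p"
    and "continuous_on S \<Phi>" "\<And>z. z \<in> S \<Longrightarrow> \<Phi> z \<in> X"
  shows "homotopic_paths X (\<Phi> \<circ> p) (\<Phi> \<circ> q)"
proof -
  have "closed_segment (p t) (q t) \<subseteq> S" if "t \<in> {0..1}" for t
    using assms that by (intro closed_segment_subset) (auto simp: path_image_def)
  then have "homotopic_paths S p q"
    using assms by (intro homotopic_paths_linear) auto
  then show ?thesis
    using assms by (intro homotopic_paths_continuous_image[where S = S]) auto
qed

lemma homotopic_paths_const_join:
  assumes "path p" "path_image p \<subseteq> X" "a = pathstart p"
  shows "homotopic_paths X ((\<lambda>_. a) +++ p) p"
proof -
  have "homotopic_paths {0..1} (linepath 0 0 +++ linepath 0 1) (linepath 0 (1::real))"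
    using homotopic_paths_lid[of "linepath 0 (1::real)" "{0..1}"]
    by (simp add: closed_segment_eq_real_ivl)
  then have "homotopic_paths X (p \<circ> (linepath 0 0 +++ linepath 0 1)) (p \<circ> linepath 0 (1::real))"
    using assms by (intro homotopic_paths_continuous_image) (auto simp: path_def path_image_def)
  moreover have "p \<circ> (linepath 0 0 +++ linepath 0 1) = (\<lambda>_. a) +++ p" "p \<circ> linepath 0 (1::real) = p"
    using assms(3) by (auto simp: fun_eq_iff joinpaths_def linepath_def pathstart_def)
  ultimately show ?thesis by simp
qed

lemma homotopic_paths_join_reverse:
  fixes p :: "real \<Rightarrow> 'a::topological_space"
  assumes "path p" "path_image p \<subseteq> X"
  shows "homotopic_paths X (p +++ reversepath p) (\<lambda>_. pathstart p)"
proof -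
  have "homotopic_paths {0..1} (linepath 0 1 +++ reversepath (linepath 0 1)) (linepath 0 (0::real))"
    using homotopic_paths_rinv[of "linepath 0 (1::real)" "{0..1}"]
    by (simp add: closed_segment_eq_real_ivl)
  then have "homotopic_paths X (p \<circ> (linepath 0 1 +++ reversepath (linepath 0 1))) (p \<circ> linepath 0 (0::real))"
    using assms by (intro homotopic_paths_continuous_image) (auto simp: path_def path_image_def)
  moreover have "p \<circ> (linepath 0 1 +++ reversepath (linepath 0 1)) = p +++ reversepath p"
       "p \<circ> linepath 0 (0::real) = (\<lambda>_. pathstart p)"
    by (auto simp: fun_eq_iff joinpaths_def reversepath_def linepath_def pathstart_def)
  ultimately show ?thesis by simp
qed

section \<open>The \<open>\<omega>\<close>-braids form a group\<close>

definition relabel :: "(nat \<Rightarrow> nat) \<Rightarrow> (real \<Rightarrow> nat \<Rightarrow> complex) \<Rightarrow> real \<Rightarrow> nat \<Rightarrow> complex" where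
  "relabel \<sigma> f = (\<lambda>t x. f t (\<sigma> x))"

lemma relabel_simps [simp]:
  "relabel \<sigma> (f +++ g) = relabel \<sigma> f +++ relabel \<sigma> g"
  "relabel \<sigma> (reversepath f) = reversepath (relabel \<sigma> f)"
  "relabel \<sigma> (relabel \<tau> f) = relabel (\<tau> \<circ> \<sigma>) f"
  "relabel id f = f"
  "relabel \<sigma> (\<lambda>_. u) = (\<lambda>_. u \<circ> \<sigma>)"
  "pathstart (relabel \<sigma> f) = pathstart f \<circ> \<sigma>"
  "pathfinish (relabel \<sigma> f) = pathfinish f \<circ> \<sigma>"
  by (auto simp: relabel_def joinpaths_def reversepath_def pathstart_def pathfinish_def fun_eq_iff)

lemma path_coordinatewise:
  "path (f :: real \<Rightarrow> nat \<Rightarrow> complex) \<longleftrightarrow> (\<forall>x. path (\<lambda>t. f t x))"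
  unfolding path_def
proof
  assume f: "continuous_on {0..1} f"
  show "\<forall>x. continuous_on {0..1} (\<lambda>t. f t x)"
    by (rule allI) (rule continuous_on_product_then_coordinatewise[OF f])
next
  assume f: "\<forall>x. continuous_on {0..1} (\<lambda>t. f t x)"
  show "continuous_on {0..1} f"
    by (rule continuous_on_coordinatewise_then_product) (rule f[rule_format])
qed

lemma F_omega_iff: "u \<in> F_omega \<longleftrightarrow> inj u"
  by (auto simp: F_omega_def inj_def)

lemma homotopic_paths_relabel:
  assumes "homotopic_paths F_omega f g" "inj \<sigma>"
  shows "homotopic_paths F_omega (relabel \<sigma> f) (relabel \<sigma> g)"
proof -
  have "continuous_on F_omega (\<lambda>u. u \<circ> \<sigma>)"
    by (rule continuous_on_coordinatewise_then_product, unfold comp_def,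
        rule continuous_on_subset[OF continuous_on_product_coordinates]) simp
  then have "homotopic_paths F_omega ((\<lambda>u. u \<circ> \<sigma>) \<circ> f) ((\<lambda>u. u \<circ> \<sigma>) \<circ> g)"
    using assms by (intro homotopic_paths_continuous_image[OF assms(1)])
      (auto simp: F_omega_iff intro: inj_compose assms)
  then show ?thesis by (simp add: relabel_def comp_def)
qed

lemma path_relabel [simp]: "path f \<Longrightarrow> path (relabel \<sigma> f)"
  by (auto simp: path_coordinatewise relabel_def)

lemma path_image_relabel: "path_image f \<subseteq> F_omega \<Longrightarrow> inj \<sigma> \<Longrightarrow> path_image (relabel \<sigma> f) \<subseteq> F_omega"
  by (auto simp: path_image_def relabel_def image_subset_iff F_omega_iff inj_def)

text \<open>
  Naming the terminal permutation \<open>\<sigma>\<close> avoids reading it back from the endpoint of \<open>f\<close>; the permutation of a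
  product \<open>[f][g]\<close> is \<open>\<tau> \<circ> \<sigma>\<close>, in reverse order.
\<close>

definition is_braid :: "(real \<Rightarrow> nat \<Rightarrow> complex) \<Rightarrow> (nat \<Rightarrow> nat) \<Rightarrow> bool" where
  "is_braid f \<sigma> \<longleftrightarrow> path f \<and> path_image f \<subseteq> F_omega \<and> pathstart f = of_nat \<and> bij \<sigma>
     \<and> pathfinish f = of_nat \<circ> \<sigma>"

lemma omega_braids_iff: "f \<in> omega_braids \<longleftrightarrow> (\<exists>\<sigma>. is_braid f \<sigma>)"
  by (auto simp: omega_braids_def is_braid_def Sigma_omega_def comp_def)

lemma perm_of_eq: "bij \<sigma> \<Longrightarrow> perm_of (of_nat \<circ> \<sigma>) = \<sigma>"
  unfolding perm_of_def by (rule the_equality) (auto simp: fun_eq_iff)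

lemma path_act_eq: "is_braid f \<sigma> \<Longrightarrow> path_act g (pathfinish f) = relabel \<sigma> g"
  by (simp add: path_act_def is_braid_def perm_of_eq relabel_def)

lemma of_nat_in_F_omega: "of_nat \<in> F_omega" by (simp add: F_omega_iff inj_of_nat)

lemma is_braid_id: "is_braid (\<lambda>_. of_nat) id"
  by (auto simp: is_braid_def path_def path_image_def pathstart_def pathfinish_def of_nat_in_F_omega)

lemma is_braid_join:
  assumes "is_braid f \<sigma>" "is_braid g \<tau>"
  shows "is_braid (f +++ relabel \<sigma> g) (\<tau> \<circ> \<sigma>)"
  using assms subset_path_image_join[OF _ path_image_relabel[of g \<sigma>], of f]
  by (auto simp: is_braid_def bij_comp bij_is_inj comp_assoc)

lemma is_braid_homotopic:
  assumes "is_braid f \<sigma>" "homotopic_paths F_omega f g"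
  shows "is_braid g \<sigma>"
  using assms homotopic_paths_imp_path[OF assms(2)] homotopic_paths_imp_subset[OF assms(2)]
    homotopic_paths_imp_pathstart[OF assms(2)] homotopic_paths_imp_pathfinish[OF assms(2)]
  by (auto simp: is_braid_def)

lemma is_braid_inverse:
  assumes "is_braid f \<sigma>"
  shows "is_braid (relabel (inv_into UNIV \<sigma>) (reversepath f)) (inv_into UNIV \<sigma>)"
proof -
  have "bij (inv_into UNIV \<sigma>)" "\<sigma> \<circ> inv_into UNIV \<sigma> = id" using assms
    by (auto simp: is_braid_def bij_imp_bij_inv bij_is_surj simp flip: surj_iff)
  then show ?thesis
  using assms path_image_relabel[of f "inv_into UNIV \<sigma>"]
  by (auto simp: is_braid_def bij_is_inj comp_assoc)
qed

lemma is_braidD: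
  assumes "is_braid f \<sigma>"
  shows "path f" "path_image f \<subseteq> F_omega" "pathstart f = of_nat" "pathfinish f = of_nat \<circ> \<sigma>"
    "bij \<sigma>" "inj \<sigma>"
  using assms by (auto simp: is_braid_def bij_is_inj)

lemma braid_class_eqI: "homotopic_paths F_omega f g \<Longrightarrow> braid_class f = braid_class g"
  unfolding braid_class_def using homotopic_paths_trans homotopic_paths_sym by blast

lemma self_in_braid_class: "is_braid f \<sigma> \<Longrightarrow> f \<in> braid_class f"
  by (auto simp: braid_class_def omega_braids_iff is_braidD)

lemma braid_class_mult:
  assumes "is_braid f \<sigma>" "is_braid g \<tau>"
  shows "braid_class f \<otimes>\<^bsub>braid_group\<^esub> braid_class g = braid_class (f +++ relabel \<sigma> g)"
proof -
  have "braid_class (f' +++ path_act g' (pathfinish f')) = braid_class (f +++ relabel \<sigma> g)"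
    if "f' \<in> braid_class f" "g' \<in> braid_class g" for f' g'
  proof -
    have h: "homotopic_paths F_omega f f'" "homotopic_paths F_omega g g'"
      using that by (auto simp: braid_class_def)
    have 1: "is_braid f' \<sigma>" "is_braid g' \<tau>" using h assms is_braid_homotopic by blast+
    have "homotopic_paths F_omega (f +++ relabel \<sigma> g) (f' +++ relabel \<sigma> g')"
      using h assms by (intro homotopic_paths_join homotopic_paths_relabel) (auto simp: is_braidD)
    then show ?thesis using 1 by (simp add: path_act_eq braid_class_eqI)
  qed
  then show ?thesis
    using self_in_braid_class[OF assms(1)] self_in_braid_class[OF assms(2)]
    by (auto simp: braid_group_def)
qed

lemma braid_group_carrier: "X \<in> carrier braid_group \<longleftrightarrow> (\<exists>f \<sigma>. is_braid f \<sigma> \<and> X = braid_class f)"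
  using omega_braids_iff by (auto simp: braid_group_def)

lemma braid_group_one: "\<one>\<^bsub>braid_group\<^esub> = braid_class (\<lambda>_. of_nat)"
  by (simp add: braid_group_def)

lemma braid_class_left_inverse:
  assumes b: "is_braid f \<sigma>"
  shows "braid_class (relabel (inv_into UNIV \<sigma>) (reversepath f)) \<otimes>\<^bsub>braid_group\<^esub> braid_class f
    = \<one>\<^bsub>braid_group\<^esub>"
proof -
  have i: "\<sigma> \<circ> inv_into UNIV \<sigma> = id" using b by (auto simp: is_braidD bij_is_surj surj_iff[symmetric])
  have "homotopic_paths F_omega (relabel (inv_into UNIV \<sigma>) (reversepath f +++ f))
      (relabel (inv_into UNIV \<sigma>) (\<lambda>_. of_nat \<circ> \<sigma>))"
    using b homotopic_paths_join_reverse[of "reversepath f" F_omega]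
    by (intro homotopic_paths_relabel) (auto simp: is_braidD bij_imp_bij_inv bij_is_inj path_image_reversepath)
  then show ?thesis
    using b is_braid_inverse[OF b] i
    by (simp add: braid_group_one braid_class_mult braid_class_eqI comp_assoc)
qed

theorem group_braid_group: "group braid_group"
proof (rule groupI)
  show "\<one>\<^bsub>braid_group\<^esub> \<in> carrier braid_group"
    using is_braid_id by (auto simp: braid_group_carrier braid_group_one)
next
  fix X Y assume "X \<in> carrier braid_group" "Y \<in> carrier braid_group"
  then show "X \<otimes>\<^bsub>braid_group\<^esub> Y \<in> carrier braid_group"
    using is_braid_join by (fastforce simp: braid_group_carrier braid_class_mult)
next
  fix X Y Z assume "X \<in> carrier braid_group" "Y \<in> carrier braid_group" "Z \<in> carrier braid_group"
  then obtain f \<sigma> g \<tau> h \<rho> where b: "is_braid f \<sigma>" "is_braid g \<tau>" "is_braid h \<rho>"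
    and X: "X = braid_class f" "Y = braid_class g" "Z = braid_class h"
    by (auto simp: braid_group_carrier)
  have "homotopic_paths F_omega (f +++ (relabel \<sigma> g +++ relabel (\<tau> \<circ> \<sigma>) h))
      ((f +++ relabel \<sigma> g) +++ relabel (\<tau> \<circ> \<sigma>) h)"
    using b by (intro homotopic_paths_assoc path_image_relabel)
      (auto simp: is_braidD comp_assoc intro: inj_compose)
  then show "X \<otimes>\<^bsub>braid_group\<^esub> Y \<otimes>\<^bsub>braid_group\<^esub> Z = X \<otimes>\<^bsub>braid_group\<^esub> (Y \<otimes>\<^bsub>braid_group\<^esub> Z)"
    using b braid_class_mult[OF is_braid_join[OF b(1,2)] b(3)]
      braid_class_mult[OF b(1) is_braid_join[OF b(2,3)]]
    by (simp add: X braid_class_mult braid_class_eqI)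
next
  fix X assume "X \<in> carrier braid_group"
  then obtain f \<sigma> where b: "is_braid f \<sigma>" and X: "X = braid_class f"
    by (auto simp: braid_group_carrier)
  have "homotopic_paths F_omega ((\<lambda>_. of_nat) +++ f) f"
    using b by (intro homotopic_paths_const_join) (auto simp: is_braidD)
  then show "\<one>\<^bsub>braid_group\<^esub> \<otimes>\<^bsub>braid_group\<^esub> X = X"
    using b is_braid_id by (simp add: X braid_group_one braid_class_mult braid_class_eqI)
  show "\<exists>Y\<in>carrier braid_group. Y \<otimes>\<^bsub>braid_group\<^esub> X = \<one>\<^bsub>braid_group\<^esub>"
    using is_braid_inverse[OF b] braid_class_left_inverse[OF b] X
    by (intro bexI[of _ "braid_class (relabel (inv_into UNIV \<sigma>) (reversepath f))"])
       (auto simp: braid_group_carrier simp del: relabel_simps(2))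
qed

interpretation B: group braid_group by (rule group_braid_group)

lemma braid_class_inverse:
  assumes "is_braid f \<sigma>"
  shows "inv\<^bsub>braid_group\<^esub> braid_class f = braid_class (relabel (inv_into UNIV \<sigma>) (reversepath f))"
  using assms is_braid_inverse[OF assms] braid_group_carrier
  by (intro B.inv_equality braid_class_left_inverse) blast+

section \<open>Permutations of the natural numbers are products of commutators\<close>

lemma infinite_split:
  fixes F :: "nat set"
  assumes "infinite F"
  obtains A B where "A \<subseteq> F" "B \<subseteq> F" "A \<inter> B = {}" "infinite A" "infinite B"
proof
  have inj: "inj (enumerate F)" using assms by (simp add: strict_mono_enumerate strict_mono_imp_inj_on)
  show "range (\<lambda>n. enumerate F (2 * n)) \<subseteq> F" "range (\<lambda>n. enumerate F (2 * n + 1)) \<subseteq> F"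
    using assms by (auto intro: enumerate_in_set)
  have "2 * m \<noteq> 2 * n + 1" for m n :: nat by presburger
  then show "range (\<lambda>n. enumerate F (2 * n)) \<inter> range (\<lambda>n. enumerate F (2 * n + 1)) = {}"
    using inj by (auto simp: inj_eq)
  show "infinite (range (\<lambda>n. enumerate F (2 * n)))" "infinite (range (\<lambda>n. enumerate F (2 * n + 1)))"
    by (rule range_inj_infinite, simp add: inj_def inj_eq[OF inj])+
qed

lemma involution_bij: "(\<And>x. f (f x) = x) \<Longrightarrow> bij f"
  by (rule o_bij[of f f]) (auto simp: fun_eq_iff)

text \<open>
  The infinite swindle: identify the natural numbers with \<open>\<nat> \<times> \<int>\<close> such that \<open>\<sigma>\<close> moves only points of row
  \<open>0\<close>; the infinitely many fixed points provide the other rows. Let \<open>S\<close> act as \<open>\<sigma>\<close> on every row \<open>j \<ge> 0\<close>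
  and let \<open>T\<close> be the shift \<open>j \<mapsto> j + 1\<close>. Then \<open>T S T\<^sup>-\<^sup>1\<close> acts as \<open>\<sigma>\<close> on every row \<open>j \<ge> 1\<close>, and
  \<open>\<sigma> = S (T S T\<^sup>-\<^sup>1)\<^sup>-\<^sup>1 = S T S\<^sup>-\<^sup>1 T\<^sup>-\<^sup>1\<close>.
\<close>

lemma perm_commutator_of_infinite_fixed:
  fixes \<sigma> :: "nat \<Rightarrow> nat"
  assumes \<sigma>: "bij \<sigma>" and fixed: "infinite {x. \<sigma> x = x}"
  obtains a b where "bij a" "bij b" "\<sigma> = a \<circ> b \<circ> inv_into UNIV a \<circ> inv_into UNIV b"
proof -
  \<comment> \<open>\<open>F\<close> becomes the union of the rows \<open>j \<noteq> 0\<close>; \<open>G\<close> only ensures that row \<open>0\<close> is infinite.\<close>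
  obtain F G where F: "F \<subseteq> {x. \<sigma> x = x}" "infinite F" and "F \<inter> G = {}" "infinite G"
    using infinite_split[OF fixed] .
  then have G: "G \<subseteq> -F" "infinite G" by auto
  define K where "K = - F"
  have K: "infinite K" using G by (auto simp: K_def dest: finite_subset)
  have \<sigma>K: "\<sigma> x \<in> K \<longleftrightarrow> x \<in> K" for x
  proof -
    have "x \<in> F \<Longrightarrow> \<sigma> x \<in> F" using F(1) by auto
    moreover have "\<sigma> x = x" if "\<sigma> x \<in> F"
      using that F(1) inj_eq[OF bij_is_inj[OF \<sigma>]] by blast
    ultimately show ?thesis by (auto simp: K_def)
  qed
  let ?J = "UNIV \<times> (- {0}) :: (nat \<times> int) set"
  have J: "infinite ?J" by (auto simp: finite_cartesian_product_iff Compl_eq_Diff_UNIV dest: finite_subset)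
  define \<phi> :: "nat \<times> int \<Rightarrow> nat" where
    "\<phi> p = (if snd p = 0 then from_nat_into K (fst p) else from_nat_into F (to_nat_on ?J p))" for p
  have 1: "bij_betw \<phi> (UNIV \<times> {0}) K"
  proof -
    have "bij_betw fst (UNIV \<times> {0::int}) (UNIV :: nat set)" by (auto simp: bij_betw_def inj_on_def)
    moreover have "bij_betw (from_nat_into K) UNIV K" using K by (simp add: bij_betw_from_nat_into)
    ultimately have "bij_betw (from_nat_into K \<circ> fst) (UNIV \<times> {0::int}) K" by (rule bij_betw_trans)
    moreover have "bij_betw \<phi> (UNIV \<times> {0}) K \<longleftrightarrow> bij_betw (from_nat_into K \<circ> fst) (UNIV \<times> {0::int}) K"
      by (rule bij_betw_cong) (auto simp: \<phi>_def)
    ultimately show ?thesis by simp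
  qed
  have 2: "bij_betw \<phi> ?J F"
  proof -
    have "bij_betw (to_nat_on ?J) ?J UNIV" using J by (simp add: to_nat_on_infinite)
    moreover have "bij_betw (from_nat_into F) UNIV F" using F by (simp add: bij_betw_from_nat_into)
    ultimately have "bij_betw (from_nat_into F \<circ> to_nat_on ?J) ?J F" by (rule bij_betw_trans)
    moreover have "bij_betw \<phi> ?J F \<longleftrightarrow> bij_betw (from_nat_into F \<circ> to_nat_on ?J) ?J F"
      by (rule bij_betw_cong) (auto simp: \<phi>_def)
    ultimately show ?thesis by simp
  qed
  have "bij_betw \<phi> (UNIV \<times> {0} \<union> ?J) (K \<union> F)"
    by (intro bij_betw_combine 1 2) (auto simp: K_def)
  moreover have "UNIV \<times> {0} \<union> ?J = UNIV" "K \<union> F = UNIV" by (auto simp: K_def)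
  ultimately have \<phi>: "bij \<phi>" by simp
  define \<psi> where "\<psi> = inv_into UNIV \<phi>"
  have \<phi>\<psi>[simp]: "\<phi> (\<psi> x) = x" "\<psi> (\<phi> p) = p" for x p
    using \<phi> by (auto simp: \<psi>_def bij_is_surj surj_f_inv_f bij_is_inj inv_f_f)
  have \<phi>K: "\<phi> p \<in> K \<longleftrightarrow> snd p = 0" for p
    using 1 2 by (cases p) (auto simp: bij_betw_def K_def)
  define s where "s i = fst (\<psi> (\<sigma> (\<phi> (i, 0))))" for i
  define s' where "s' i = fst (\<psi> (inv_into UNIV \<sigma> (\<phi> (i, 0))))" for i
  have \<sigma>\<phi>: "\<sigma> (\<phi> (i, j)) = \<phi> (if j = 0 then s i else i, j)" for i j
  proof (cases "j = 0")
    case True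
    have "snd (\<psi> (\<sigma> (\<phi> (i, 0)))) = 0" using \<phi>K[of "\<psi> (\<sigma> (\<phi> (i, 0)))"] \<sigma>K \<phi>K[of "(i, 0)"] by simp
    then have "\<psi> (\<sigma> (\<phi> (i, 0))) = (s i, 0)" by (simp add: s_def prod_eq_iff)
    then have "\<phi> (\<psi> (\<sigma> (\<phi> (i, 0)))) = \<phi> (s i, 0)" by (rule arg_cong)
    then show ?thesis using True by simp
  next
    case False
    then have "\<phi> (i, j) \<in> F" using \<phi>K[of "(i, j)"] by (simp add: K_def)
    then show ?thesis using False F by auto
  qed
  have inv0: "inv_into UNIV \<sigma> (\<phi> (i, 0)) = \<phi> (s' i, 0)" for i
  proof -
    let ?x = "inv_into UNIV \<sigma> (\<phi> (i, 0))"
    have "\<sigma> ?x = \<phi> (i, 0)" using \<sigma> by (simp add: bij_is_surj surj_f_inv_f)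
    then have "snd (\<psi> ?x) = 0" using \<phi>K[of "\<psi> ?x"] \<sigma>K[of ?x] \<phi>K[of "(i, 0)"] by simp
    then have "\<psi> ?x = (s' i, 0)" by (simp add: s'_def prod_eq_iff)
    then have "\<phi> (\<psi> ?x) = \<phi> (s' i, 0)" by (rule arg_cong)
    then show ?thesis by simp
  qed
  have "\<phi> (s (s' i), 0) = \<phi> (i, 0)" "\<phi> (s' (s i), 0) = \<phi> (i, 0)" for i
  proof -
    show "\<phi> (s (s' i), 0) = \<phi> (i, 0)"
      using \<sigma>\<phi>[of "s' i" 0] surj_f_inv_f[OF bij_is_surj[OF \<sigma>], of "\<phi> (i, 0)"] unfolding inv0 by simp
    show "\<phi> (s' (s i), 0) = \<phi> (i, 0)"
      using inv_f_f[OF bij_is_inj[OF \<sigma>], of "\<phi> (i, 0)"] unfolding \<sigma>\<phi> by (simp add: inv0)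
  qed
  then have ss': "s (s' i) = i" "s' (s i) = i" for i
    using \<phi> by (simp_all add: bij_is_inj inj_eq)
  define S where "S = (\<lambda>(i, j). (if j \<ge> (0::int) then s i else i, j))"
  define S' where "S' = (\<lambda>(i, j). (if j \<ge> (0::int) then s' i else i, j))"
  define T where "T = (\<lambda>(i::nat, j::int). (i, j + 1))"
  define T' where "T' = (\<lambda>(i::nat, j::int). (i, j - 1))"
  define a where "a = \<phi> \<circ> S \<circ> \<psi>"
  define b where "b = \<phi> \<circ> T \<circ> \<psi>"
  have "S (S' p) = p" "S' (S p) = p" "T (T' p) = p" "T' (T p) = p" for p
    by (cases p; auto simp: S_def S'_def T_def T'_def ss')+
  then have a: "a \<circ> (\<phi> \<circ> S' \<circ> \<psi>) = id" "(\<phi> \<circ> S' \<circ> \<psi>) \<circ> a = id"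
    and b: "b \<circ> (\<phi> \<circ> T' \<circ> \<psi>) = id" "(\<phi> \<circ> T' \<circ> \<psi>) \<circ> b = id"
    by (auto simp: fun_eq_iff a_def b_def)
  have \<sigma>S: "\<sigma> (\<phi> p) = (a \<circ> b \<circ> (\<phi> \<circ> S' \<circ> \<psi>) \<circ> (\<phi> \<circ> T' \<circ> \<psi>)) (\<phi> p)" for p
    by (cases p) (auto simp: \<sigma>\<phi> a_def b_def S_def S'_def T_def T'_def ss')
  have "\<sigma> x = (a \<circ> b \<circ> (\<phi> \<circ> S' \<circ> \<psi>) \<circ> (\<phi> \<circ> T' \<circ> \<psi>)) x" for x
    using \<sigma>S[of "\<psi> x"] by (simp only: \<phi>\<psi>(1))
  then have "\<sigma> = a \<circ> b \<circ> (\<phi> \<circ> S' \<circ> \<psi>) \<circ> (\<phi> \<circ> T' \<circ> \<psi>)" by blast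
  moreover have "bij a" "bij b" using a b o_bij by blast+
  moreover have "inv_into UNIV a = \<phi> \<circ> S' \<circ> \<psi>" "inv_into UNIV b = \<phi> \<circ> T' \<circ> \<psi>"
    using a b by (auto intro: inv_unique_comp)
  ultimately show ?thesis using that[of a b] by simp
qed

text \<open>
  A maximal set disjoint from its image is infinite: if it were finite, any moved point away from it,
  its image and its preimage could be added.
\<close>

lemma infinite_moved_apart:
  fixes \<sigma> :: "nat \<Rightarrow> nat"
  assumes "inj \<sigma>" "infinite {x. \<sigma> x \<noteq> x}"
  obtains Z where "infinite Z" "Z \<inter> \<sigma> ` Z = {}"
proof -
  let ?A = "{Z. Z \<inter> \<sigma> ` Z = {}}"
  have "\<exists>M\<in>?A. \<forall>X\<in>?A. M \<subseteq> X \<longrightarrow> X = M"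
  proof (rule subset_Zorn_nonempty)
    fix C assume C: "C \<noteq> {}" "subset.chain ?A C"
    have False if "x \<in> X" "\<sigma> x \<in> Y" "X \<in> C" "Y \<in> C" for x X Y
    proof -
      have "X \<inter> \<sigma> ` X = {}" "Y \<inter> \<sigma> ` Y = {}" "X \<subseteq> Y \<or> Y \<subseteq> X"
        using C(2) that(3,4) unfolding subset_chain_def by blast+
      with that(1,2) show False by blast
    qed
    then have "\<Union>C \<inter> \<sigma> ` \<Union>C = {}" by blast
    then show "\<Union>C \<in> ?A" by simp
  qed auto
  then obtain Z where Z: "Z \<inter> \<sigma> ` Z = {}" and max: "\<And>X. X \<inter> \<sigma> ` X = {} \<Longrightarrow> Z \<subseteq> X \<Longrightarrow> X = Z"
    by auto
  have "infinite Z"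
  proof
    assume "finite Z"
    then have "finite (Z \<union> \<sigma> ` Z \<union> \<sigma> -` Z)" using assms(1) by (auto intro: finite_vimageI)
    then obtain x where x: "\<sigma> x \<noteq> x" "x \<notin> Z" "x \<notin> \<sigma> ` Z" "\<sigma> x \<notin> Z"
      using assms(2) finite_subset[of "{x. \<sigma> x \<noteq> x}" "Z \<union> \<sigma> ` Z \<union> \<sigma> -` Z"] by blast
    then have "insert x Z = Z" using Z by (intro max) auto
    then show False using x by auto
  qed
  then show ?thesis using Z that by blast
qed

text \<open>
  A permutation with infinitely many fixed points is a commutator. Otherwise choose disjoint infinite
  sets \<open>A\<close>, \<open>B\<close> with \<open>A \<union> B\<close> disjoint from its image, and let \<open>\<tau>\<close> be the involution that interchanges \<open>A\<close>
  and \<open>\<sigma> ` A\<close> via \<open>\<sigma>\<close>. Then \<open>\<tau>\<close> fixes \<open>B\<close>, \<open>\<tau> \<circ> \<sigma>\<close> fixes \<open>A\<close>, and \<open>\<sigma> = \<tau> \<circ> (\<tau> \<circ> \<sigma>)\<close>.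
\<close>

lemma perm_commutator_induct:
  fixes \<sigma> :: "nat \<Rightarrow> nat"
  assumes comm: "\<And>a b. bij a \<Longrightarrow> bij b \<Longrightarrow> P (a \<circ> b \<circ> inv_into UNIV a \<circ> inv_into UNIV b)"
    and comp: "\<And>a b. P a \<Longrightarrow> P b \<Longrightarrow> P (a \<circ> b)" and \<sigma>: "bij \<sigma>"
  shows "P \<sigma>"
proof -
  have P: "P \<rho>" if "bij \<rho>" "infinite {x. \<rho> x = x}" for \<rho>
    using perm_commutator_of_infinite_fixed[OF that] comm by metis
  show ?thesis
  proof (cases "infinite {x. \<sigma> x = x}")
    case True
    then show ?thesis using P \<sigma> by blast
  next
    case False
    then have "infinite (- {x. \<sigma> x = x})" using finite_compl by blast
    then have "infinite {x. \<sigma> x \<noteq> x}" by (simp add: Collect_neg_eq)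
    then obtain Z where Z: "infinite Z" "Z \<inter> \<sigma> ` Z = {}"
      using infinite_moved_apart bij_is_inj[OF \<sigma>] by metis
    obtain A B where AB: "A \<subseteq> Z" "B \<subseteq> Z" "A \<inter> B = {}" "infinite A" "infinite B"
      using infinite_split[OF Z(1)] by blast
    have inv: "inv_into UNIV \<sigma> (\<sigma> x) = x" for x using \<sigma> by (simp add: bij_is_inj inv_f_f)
    define \<tau> where "\<tau> x = (if x \<in> A then \<sigma> x else if x \<in> \<sigma> ` A then inv_into UNIV \<sigma> x else x)" for x
    have A: "\<sigma> x \<notin> A" if "x \<in> A" for x using that AB(1) Z(2) by blast
    have \<tau>\<tau>: "\<tau> (\<tau> x) = x" for x using A by (auto simp: \<tau>_def inv)
    have "\<tau> x = x" if "x \<in> B" for x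
      using that AB Z by (simp add: \<tau>_def) blast
    then have "infinite {x. \<tau> x = x}" using infinite_super[of B "{x. \<tau> x = x}"] AB(5) by blast
    then have "P \<tau>" using P involution_bij[of \<tau>] \<tau>\<tau> by blast
    moreover have "(\<tau> \<circ> \<sigma>) x = x" if "x \<in> A" for x using that A by (auto simp: \<tau>_def inv)
    then have "infinite {x. (\<tau> \<circ> \<sigma>) x = x}"
      using infinite_super[of A "{x. (\<tau> \<circ> \<sigma>) x = x}"] AB(4) by blast
    then have "P (\<tau> \<circ> \<sigma>)" using P bij_comp[OF \<sigma> involution_bij[of \<tau>]] \<tau>\<tau> by blast
    ultimately have "P (\<tau> \<circ> (\<tau> \<circ> \<sigma>))" by (rule comp)
    also have "\<tau> \<circ> (\<tau> \<circ> \<sigma>) = \<sigma>" by (simp add: fun_eq_iff \<tau>\<tau>)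
    finally show ?thesis .
  qed
qed

section \<open>Extending homotopies of finitely many strands to all strands\<close>

lemma finite_uniform_radius:
  fixes P :: "'i \<Rightarrow> real \<Rightarrow> bool"
  assumes "finite I" "\<And>i. i \<in> I \<Longrightarrow> \<exists>d>0. P i d"
    and mono: "\<And>i d e. P i d \<Longrightarrow> 0 < e \<Longrightarrow> e \<le> d \<Longrightarrow> P i e"
  shows "\<exists>d>0. \<forall>i\<in>I. P i d"
  using assms(1,2)
proof (induction I)
  case empty
  show ?case by (intro exI[of _ 1]) simp
next
  case (insert i I)
  then obtain d e where "d > 0" "\<forall>j\<in>I. P j d" "e > 0" "P i e" by blast
  then show ?case by (intro exI[of _ "min d e"]) (auto intro: mono)
qed

text \<open>
  The displacement field is a sum of \<open>n\<close> bumps, each Lipschitz with constant at most \<open>1 / (n + 1)\<close>. The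
  sum is therefore a contraction, and the identity plus a contraction is injective.
\<close>

lemma bump_displacement_inj:
  fixes z z' :: complex and p v :: "nat \<Rightarrow> complex"
  assumes "z \<noteq> z'" "\<delta> > 0" and v: "\<And>i. i < n \<Longrightarrow> norm (v i) \<le> \<delta> / (real n + 1)"
  shows "z + (\<Sum>i<n. of_real (max 0 (1 - norm (z - p i) / \<delta>)) * v i)
    \<noteq> z' + (\<Sum>i<n. of_real (max 0 (1 - norm (z' - p i) / \<delta>)) * v i)"
proof
  let ?b = "\<lambda>z i. max 0 (1 - norm (z - p i) / \<delta>)"
  have b: "\<bar>?b z i - ?b z' i\<bar> \<le> norm (z - z') / \<delta>" for i
  proof -
    have "\<bar>?b z i - ?b z' i\<bar> \<le> \<bar>norm (z - p i) / \<delta> - norm (z' - p i) / \<delta>\<bar>" by linarith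
    also have "\<dots> = \<bar>norm (z - p i) - norm (z' - p i)\<bar> / \<delta>"
      using \<open>\<delta> > 0\<close> by (simp flip: diff_divide_distrib)
    also have "\<dots> \<le> norm (z - z') / \<delta>"
      using \<open>\<delta> > 0\<close> norm_triangle_ineq3[of "z - p i" "z' - p i"] by (intro divide_right_mono) auto
    finally show ?thesis .
  qed
  assume "z + (\<Sum>i<n. of_real (?b z i) * v i) = z' + (\<Sum>i<n. of_real (?b z' i) * v i)"
  then have "z - z' = (\<Sum>i<n. of_real (?b z' i) * v i) - (\<Sum>i<n. of_real (?b z i) * v i)"
    by (simp add: algebra_simps)
  also have "\<dots> = (\<Sum>i<n. of_real (?b z' i - ?b z i) * v i)"
    by (simp only: sum_subtractf[symmetric] left_diff_distrib of_real_diff)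
  finally have "norm (z - z') = norm (\<Sum>i<n. of_real (?b z' i - ?b z i) * v i)" by simp
  also have "\<dots> \<le> (\<Sum>i<n. norm (z - z') / \<delta> * (\<delta> / (real n + 1)))"
  proof (rule sum_norm_le)
    fix i assume "i \<in> {..<n}"
    then have "norm (v i) \<le> \<delta> / (real n + 1)" using v by simp
    moreover have "\<bar>?b z' i - ?b z i\<bar> \<le> norm (z - z') / \<delta>" using b[of i] by (simp only: abs_minus_commute)
    ultimately show "norm (of_real (?b z' i - ?b z i) * v i) \<le> norm (z - z') / \<delta> * (\<delta> / (real n + 1))"
      unfolding norm_mult norm_of_real using \<open>\<delta> > 0\<close> by (intro mult_mono) auto
  qed
  also have "\<dots> = norm (z - z') * (real n / (real n + 1))" using \<open>\<delta> > 0\<close> by simp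
  also have "\<dots> < norm (z - z') * 1" using assms(1) by (intro mult_strict_left_mono) auto
  finally show False by simp
qed

text \<open>
  When the first \<open>n\<close> points of a configuration move by little compared with their distance \<open>\<delta>\<close>, the bump
  displacement centred at these points drags the whole plane along: it is injective, carries the
  \<open>i\<close>-th point to its new position (the bumps at the other points vanish there), and depends continuously
  on everything. Applying it to all strands keeps them distinct.
\<close>

lemma lift_small_deformation:
  fixes f :: "real \<Rightarrow> nat \<Rightarrow> complex" and G :: "real \<times> real \<Rightarrow> nat \<Rightarrow> complex"
  assumes f: "path f" "path_image f \<subseteq> F_omega"
    and G: "\<And>i. i < n \<Longrightarrow> continuous_on ({0..1} \<times> {0..1}) (\<lambda>z. G z i)"
    and start: "\<And>t i. t \<in> {0..1} \<Longrightarrow> i < n \<Longrightarrow> G (0, t) i = f t i"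
    and ends: "\<And>s i. s \<in> {0..1} \<Longrightarrow> i < n \<Longrightarrow> G (s, 0) i = f 0 i" 
      "\<And>s i. s \<in> {0..1} \<Longrightarrow> i < n \<Longrightarrow> G (s, 1) i = f 1 i"
    and sep: "\<delta> > 0" "\<And>t i j. t \<in> {0..1} \<Longrightarrow> i < n \<Longrightarrow> j < n \<Longrightarrow> i \<noteq> j \<Longrightarrow> \<delta> \<le> norm (f t i - f t j)"
    and small: "\<And>s t i. s \<in> {0..1} \<Longrightarrow> t \<in> {0..1} \<Longrightarrow> i < n \<Longrightarrow>
      norm (G (s, t) i - f t i) \<le> \<delta> / (real n + 1)"
  shows "\<exists>g. homotopic_paths F_omega f g \<and> (\<forall>t\<in>{0..1}. \<forall>i<n. g t i = G (1, t) i)"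
proof -
  define K :: "real \<times> real \<Rightarrow> nat \<Rightarrow> complex" where
    "K z x = f (snd z) x + (\<Sum>i<n. of_real (max 0 (1 - norm (f (snd z) x - f (snd z) i) / \<delta>)) * (G z i - f (snd z) i))"
    for z x
  have fx: "continuous_on {0..1} (\<lambda>t. f t x)" for x
    using f(1) unfolding path_coordinatewise by (simp add: path_def)
  have fxz: "continuous_on ({0..1} \<times> {0..1}) (\<lambda>z. f (snd z) x)" for x :: nat
    by (rule continuous_on_compose2[OF fx[of x]]) (auto intro: continuous_on_snd continuous_on_id)
  have "continuous_on ({0..1} \<times> {0..1}) (\<lambda>z. K z x)" for x
    unfolding K_def using sep(1)
    by (intro continuous_on_add continuous_on_sum continuous_on_mult continuous_on_of_real
        continuous_on_max continuous_on_const continuous_on_diff continuous_on_divide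
        continuous_on_norm fxz G) simp_all
  then have 1: "continuous_on ({0..1} \<times> {0..1}) K"
    by (rule continuous_on_coordinatewise_then_product)
  have 2: "K (s, t) \<in> F_omega" if "s \<in> {0..1}" "t \<in> {0..1}" for s t
  proof -
    have "f t x \<noteq> f t y" if "x \<noteq> y" for x y
    proof -
      have "f t \<in> F_omega" using f(2) \<open>t \<in> {0..1}\<close> by (auto simp: path_image_def)
      then show ?thesis using that by (auto simp: F_omega_def)
    qed
    then have "K (s, t) x \<noteq> K (s, t) y" if "x \<noteq> y" for x y
      unfolding K_def snd_conv using that sep(1) small[OF \<open>s \<in> {0..1}\<close> \<open>t \<in> {0..1}\<close>]
      by (intro bump_displacement_inj) simp_all
    then show ?thesis by (simp add: F_omega_def)
  qed
  have 3: "K (0, t) = f t" if "t \<in> {0..1}" for t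
    using start that by (simp add: K_def fun_eq_iff)
  have 4: "K (s, 0) = f 0" "K (s, 1) = f 1" if "s \<in> {0..1}" for s
    using ends that by (simp_all add: K_def fun_eq_iff)
  have 5: "K (1, t) i = G (1, t) i" if "t \<in> {0..1}" "i < n" for t i
  proof -
    have "(\<Sum>j<n. of_real (max 0 (1 - norm (f t i - f t j) / \<delta>)) * (G (1, t) j - f t j))
      = (\<Sum>j<n. if j = i then G (1, t) i - f t i else 0)"
      using sep that by (intro sum.cong) auto
    then show ?thesis using that by (simp add: K_def)
  qed
  have "homotopic_paths F_omega f (\<lambda>t. K (1, t))"
    unfolding homotopic_paths
    using 1 2 3 4 by (intro exI[of _ K]) (auto simp: pathstart_def pathfinish_def)
  then show ?thesis using 5 by blast
qed

text \<open>
  Configurations whose first \<open>n\<close> points are distinct. The other points are kept but may collide, so this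
  is the configuration space of \<open>n\<close> points times a contractible factor, and it contains every
  configuration of infinitely many points as it is.
\<close>

definition F_first :: "nat \<Rightarrow> (nat \<Rightarrow> complex) set" where
  "F_first n = {u. inj_on u {..<n}}"

lemma F_omega_subset_F_first: "F_omega \<subseteq> F_first n"
  by (auto simp: F_omega_iff F_first_def intro: inj_on_subset)

text \<open>
  By compactness the first \<open>n\<close> strands keep a common minimal distance \<open>\<delta>\<close> throughout the homotopy, and the
  homotopy splits into finitely many stages \<open>k/N \<le> s \<le> (k + 1)/N\<close>, each of them small enough for
  \<open>lift_small_deformation\<close>.
\<close>

lemma lift_homotopy_of_first_strands:
  assumes f: "path f" "path_image f \<subseteq> F_omega" and fg: "homotopic_paths (F_first n) f g"
  shows "\<exists>f'. homotopic_paths F_omega f f' \<and> (\<forall>t\<in>{0..1}. \<forall>i<n. f' t i = g t i)"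
proof -
  let ?Q = "{0..1::real} \<times> {0..1::real}"
  obtain h where h: "continuous_on ?Q h" "h \<in> ?Q \<rightarrow> F_first n"
    "\<forall>x\<in>{0..1}. h (0, x) = f x" "\<forall>x\<in>{0..1}. h (1, x) = g x"
    "\<forall>s\<in>{0..1}. h (s, 0) = f 0 \<and> h (s, 1) = f 1"
    using fg unfolding homotopic_paths pathstart_def pathfinish_def o_def by blast
  have hi: "continuous_on ?Q (\<lambda>z. h z i)" for i
    by (rule continuous_on_product_then_coordinatewise[OF h(1)])
  have Q: "compact ?Q" "?Q \<noteq> {}" by (auto intro: compact_Times)
  have "\<exists>d>0. \<forall>p\<in>{p \<in> {..<n} \<times> {..<n}. fst p \<noteq> snd p}. \<forall>z\<in>?Q. d \<le> norm (h z (fst p) - h z (snd p))"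
  proof (rule finite_uniform_radius)
    fix p assume p: "p \<in> {p \<in> {..<n} \<times> {..<n}. fst p \<noteq> snd p}"
    have "continuous_on ?Q (\<lambda>z. norm (h z (fst p) - h z (snd p)))"
      by (intro continuous_on_norm continuous_on_diff hi)
    then obtain z where z: "z \<in> ?Q" "\<forall>y\<in>?Q. norm (h z (fst p) - h z (snd p)) \<le> norm (h y (fst p) - h y (snd p))"
      using continuous_attains_inf[OF Q] by blast
    have "h z \<in> F_first n" using z(1) h(2) by blast
    then have "norm (h z (fst p) - h z (snd p)) > 0" using p by (auto simp: F_first_def inj_on_def)
    then show "\<exists>d>0. \<forall>z\<in>?Q. d \<le> norm (h z (fst p) - h z (snd p))" using z(2) by blast
  next
    show "\<forall>z\<in>?Q. e \<le> norm (h z (fst p) - h z (snd p))"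
      if "\<forall>z\<in>?Q. d \<le> norm (h z (fst p) - h z (snd p))" "e \<le> d" for p and d e :: real
    proof
      fix z assume "z \<in> ?Q"
      then have "d \<le> norm (h z (fst p) - h z (snd p))" using that(1) by (rule bspec[rotated])
      then show "e \<le> norm (h z (fst p) - h z (snd p))" using that(2) by linarith
    qed
  qed simp
  then obtain \<delta> where \<delta>: "\<delta> > 0" and \<delta>': "\<forall>p\<in>{p \<in> {..<n} \<times> {..<n}. fst p \<noteq> snd p}. \<forall>z\<in>?Q.
      \<delta> \<le> norm (h z (fst p) - h z (snd p))" by blast
  have sep: "\<delta> \<le> norm (h z i - h z j)" if "i < n" "j < n" "i \<noteq> j" "z \<in> ?Q" for i j z
    using \<delta>'[rule_format, of "(i, j)" z] that by simp
  have "\<exists>e>0. \<forall>i\<in>{..<n}. \<forall>s\<in>{0..1}. \<forall>s'\<in>{0..1}. \<forall>t\<in>{0..1}. \<bar>s' - s\<bar> < e \<longrightarrow>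
      norm (h (s', t) i - h (s, t) i) < \<delta> / (real n + 1)"
  proof (rule finite_uniform_radius)
    fix i
    have "uniformly_continuous_on ?Q (\<lambda>z. h z i)"
      by (rule compact_uniformly_continuous[OF hi Q(1)])
    moreover have "\<delta> / (real n + 1) > 0" using \<delta> by simp
    ultimately obtain e where e: "e > 0"
      "\<And>z z'. z \<in> ?Q \<Longrightarrow> z' \<in> ?Q \<Longrightarrow> dist z' z < e \<Longrightarrow> dist (h z' i) (h z i) < \<delta> / (real n + 1)"
      unfolding uniformly_continuous_on_def by blast
    have "norm (h (s', t) i - h (s, t) i) < \<delta> / (real n + 1)"
      if "s \<in> {0..1}" "s' \<in> {0..1}" "t \<in> {0..1}" "\<bar>s' - s\<bar> < e" for s s' t
      using e(2)[of "(s, t)" "(s', t)"] that by (auto simp: dist_norm dist_Pair_Pair)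
    then show "\<exists>e>0. \<forall>s\<in>{0..1}. \<forall>s'\<in>{0..1}. \<forall>t\<in>{0..1}. \<bar>s' - s\<bar> < e \<longrightarrow>
      norm (h (s', t) i - h (s, t) i) < \<delta> / (real n + 1)" using e(1) by blast
  next
    show "\<forall>s\<in>{0..1}. \<forall>s'\<in>{0..1}. \<forall>t\<in>{0..1}. \<bar>s' - s\<bar> < e \<longrightarrow> norm (h (s', t) i - h (s, t) i) < \<delta> / (real n + 1)"
      if "\<forall>s\<in>{0..1}. \<forall>s'\<in>{0..1}. \<forall>t\<in>{0..1}. \<bar>s' - s\<bar> < d \<longrightarrow> norm (h (s', t) i - h (s, t) i) < \<delta> / (real n + 1)"
        "e \<le> d" for i d e
    proof (intro ballI impI)
      fix s s' t :: real assume "s \<in> {0..1}" "s' \<in> {0..1}" "t \<in> {0..1}" "\<bar>s' - s\<bar> < e"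
      moreover from this have "\<bar>s' - s\<bar> < d" using that(2) by linarith
      ultimately show "norm (h (s', t) i - h (s, t) i) < \<delta> / (real n + 1)" using that(1) by simp
    qed
  qed simp
  then obtain e where e: "e > 0" and small':
    "\<forall>i\<in>{..<n}. \<forall>s\<in>{0..1}. \<forall>s'\<in>{0..1}. \<forall>t\<in>{0..1}. \<bar>s' - s\<bar> < e \<longrightarrow>
      norm (h (s', t) i - h (s, t) i) < \<delta> / (real n + 1)" by blast
  have small: "\<And>i s s' t. i < n \<Longrightarrow> s \<in> {0..1} \<Longrightarrow> s' \<in> {0..1} \<Longrightarrow> t \<in> {0..1} \<Longrightarrow>
     \<bar>s' - s\<bar> < e \<Longrightarrow> norm (h (s', t) i - h (s, t) i) < \<delta> / (real n + 1)"
    using small' by simp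
  obtain N :: nat where "N > 0" and N: "1 / real N < e"
  proof -
    obtain M where "inverse (real (Suc M)) < e" using reals_Archimedean[OF e] by blast
    then show ?thesis using that[of "Suc M"] by (simp add: inverse_eq_divide)
  qed
  have "\<exists>f'. homotopic_paths F_omega f f' \<and> (\<forall>t\<in>{0..1}. \<forall>i<n. f' t i = h (real k / real N, t) i)" if "k \<le> N" for k
    using that
  proof (induction k)
    case 0
    show ?case using f h(3) by (intro exI[of _ f]) auto
  next
    case (Suc k)
    then obtain f' where f': "homotopic_paths F_omega f f'"
      "\<And>t i. t \<in> {0..1} \<Longrightarrow> i < n \<Longrightarrow> f' t i = h (real k / real N, t) i" by auto
    define G where "G z = h ((real k + fst z) / real N, snd z)" for z
    have in01: "(real k + s) / real N \<in> {0..1}" if "s \<in> {0..1}" for s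
      using that Suc.prems \<open>N > 0\<close> by auto
    have k01: "real k / real N \<in> {0..1}" using in01[of 0] by simp
    have "\<exists>g. homotopic_paths F_omega f' g \<and> (\<forall>t\<in>{0..1}. \<forall>i<n. g t i = G (1, t) i)"
    proof (rule lift_small_deformation[where \<delta> = \<delta>])
      show "path f'" "path_image f' \<subseteq> F_omega"
        using homotopic_paths_imp_path[OF f'(1)] homotopic_paths_imp_subset[OF f'(1)] by auto
      show "continuous_on ?Q (\<lambda>z. G z i)" for i
      proof -
        have "continuous_on ?Q (\<lambda>z. ((real k + fst z) / real N, snd z))"
          using \<open>N > 0\<close> by (intro continuous_on_Pair continuous_on_divide continuous_on_add continuous_on_const
              continuous_on_fst continuous_on_snd continuous_on_id) auto
        then show ?thesis unfolding G_def
          by (rule continuous_on_compose2[OF hi]) (use in01 in auto)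
      qed
      show "G (0, t) i = f' t i" if "t \<in> {0..1}" "i < n" for t i
        using f'(2)[OF that] by (simp add: G_def)
      show "G (s, 0) i = f' 0 i" "G (s, 1) i = f' 1 i" if "s \<in> {0..1}" "i < n" for s i
        using f'(2)[of 0 i] f'(2)[of 1 i] h(5) in01[OF that(1)] k01 that by (simp_all add: G_def)
      show "\<delta> > 0" by fact
      show "\<delta> \<le> norm (f' t i - f' t j)" if "t \<in> {0..1}" "i < n" "j < n" "i \<noteq> j" for t i j
        using sep[of i j "(real k / real N, t)"] f'(2) k01 that by auto
      show "norm (G (s, t) i - f' t i) \<le> \<delta> / (real n + 1)" if "s \<in> {0..1}" "t \<in> {0..1}" "i < n" for s t i
      proof -
        have "\<bar>(real k + s) / real N - real k / real N\<bar> = s / real N"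
          using that by (simp add: add_divide_distrib)
        also have "\<dots> \<le> 1 / real N" using that by (intro divide_right_mono) auto
        also have "\<dots> < e" by fact
        finally show ?thesis
          using small[OF that(3) k01 in01[OF that(1)] that(2)] f'(2)[OF that(2,3)] by (simp add: G_def less_imp_le)
      qed
    qed
    then obtain g where g: "homotopic_paths F_omega f' g" "\<forall>t\<in>{0..1}. \<forall>i<n. g t i = G (1, t) i"
      by blast
    have "homotopic_paths F_omega f g" using f'(1) g(1) by (rule homotopic_paths_trans)
    then show ?case using g(2) by (intro exI[of _ g]) (simp add: G_def add.commute)
  qed
  from this[of N] show ?thesis using h(4) \<open>N > 0\<close> by auto
qed

section \<open>Explicit braids and a change of base configuration\<close>

lemma continuous_square_path:
  assumes "continuous_on ({0..1} \<times> {0..1}) \<Phi>" "continuous_on {0..1} a" "continuous_on {0..1} b"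
    "\<And>t. t \<in> {0..1} \<Longrightarrow> a t \<in> {0..1}" "\<And>t. t \<in> {0..1} \<Longrightarrow> b t \<in> {0..1}"
  shows "path (\<lambda>t. \<Phi> (a t, b t))"
  unfolding path_def
  by (rule continuous_on_compose2[OF assms(1)]) (use assms in \<open>auto intro!: continuous_on_Pair\<close>)

text \<open>
  All homotopies between explicit motions below come from a two-parameter family of configurations:
  running the two parameters one after the other, in either order, or simultaneously gives homotopic
  paths.
\<close>

lemma homotopic_paths_square:
  fixes \<Phi> :: "real \<times> real \<Rightarrow> 'a::topological_space"
  assumes "continuous_on ({0..1} \<times> {0..1}) \<Phi>" "\<And>z. z \<in> {0..1} \<times> {0..1} \<Longrightarrow> \<Phi> z \<in> X"
  shows "homotopic_paths X ((\<lambda>t. \<Phi> (t, 0)) +++ (\<lambda>t. \<Phi> (1, t))) (\<lambda>t. \<Phi> (t, t))" (is ?diagonal)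
    and "homotopic_paths X ((\<lambda>t. \<Phi> (t, 0)) +++ (\<lambda>t. \<Phi> (1, t))) ((\<lambda>t. \<Phi> (0, t)) +++ (\<lambda>t. \<Phi> (t, 1)))"
      (is ?edges)
proof -
  let ?Q = "{0..1} \<times> {0..1} :: (real \<times> real) set"
  let ?l = "linepath (0, 0) (1, 0) +++ linepath (1, 0) (1, 1) :: real \<Rightarrow> real \<times> real"
  have Q: "convex ?Q" by (simp add: convex_Times)
  have sub: "closed_segment a b \<subseteq> ?Q" if "a \<in> ?Q" "b \<in> ?Q" for a b
    by (rule closed_segment_subset[OF that Q])
  have l: "\<Phi> \<circ> ?l = (\<lambda>t. \<Phi> (t, 0)) +++ (\<lambda>t. \<Phi> (1, t))"
    by (auto simp: fun_eq_iff joinpaths_def linepath_def)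
  have "homotopic_paths X (\<Phi> \<circ> ?l) (\<Phi> \<circ> linepath (0, 0) (1, 1))"
    by (rule homotopic_paths_convex_image[OF Q])
       (use assms in \<open>auto simp: path_image_join sub simp del: mem_Times_iff intro!: subset_path_image_join sub\<close>)
  moreover have "\<Phi> \<circ> linepath (0, 0) (1, 1) = (\<lambda>t. \<Phi> (t, t))"
    by (auto simp: fun_eq_iff linepath_def)
  ultimately show ?diagonal by (simp add: l)
  have "homotopic_paths X (\<Phi> \<circ> ?l) (\<Phi> \<circ> (linepath (0, 0) (0, 1) +++ linepath (0, 1) (1, 1)))"
    by (rule homotopic_paths_convex_image[OF Q])
       (use assms in \<open>auto simp: path_image_join sub simp del: mem_Times_iff intro!: subset_path_image_join sub\<close>)
  moreover have "\<Phi> \<circ> (linepath (0, 0) (0, 1) +++ linepath (0, 1) (1, 1))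
      = (\<lambda>t. \<Phi> (0, t)) +++ (\<lambda>t. \<Phi> (t, 1))"
    by (auto simp: fun_eq_iff joinpaths_def linepath_def)
  ultimately show ?edges by (simp add: l)
qed

text \<open>
  Straight motion of real points would collide. The term \<open>t (1 - t) h\<close> lifts strand \<open>x\<close> into its own
  horizontal level \<open>h x\<close> on the way, so that strands with different levels pass each other.
\<close>

definition arc_path :: "(nat \<Rightarrow> real) \<Rightarrow> (nat \<Rightarrow> real) \<Rightarrow> (nat \<Rightarrow> real) \<Rightarrow> real \<Rightarrow> nat \<Rightarrow> complex" where
  "arc_path u v h = (\<lambda>t x. Complex ((1 - t) * u x + t * v x) (t * (1 - t) * h x))"

lemma arc_path_ends [simp]:
  "pathstart (arc_path u v h) = of_real \<circ> u" "pathfinish (arc_path u v h) = of_real \<circ> v"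
  by (auto simp: arc_path_def pathstart_def pathfinish_def fun_eq_iff complex_eq_iff)

lemma path_arc_path [simp]: "path (arc_path u v h)"
  unfolding path_coordinatewise arc_path_def path_def Complex_eq
  by (intro allI continuous_intros)

lemma path_image_arc_path:
  assumes "inj u" "inj v" "\<And>x y. x \<noteq> y \<Longrightarrow> h x = h y \<Longrightarrow> u x = v x \<and> u y = v y"
  shows "path_image (arc_path u v h) \<subseteq> F_omega"
proof -
  have "arc_path u v h t x \<noteq> arc_path u v h t y" if t: "t \<in> {0..1}" and xy: "x \<noteq> y" for t x y
  proof
    assume eq: "arc_path u v h t x = arc_path u v h t y"
    have uv: "u x \<noteq> u y" "v x \<noteq> v y" using assms(1,2) xy by (auto simp: inj_eq)
    consider "t = 0" | "t = 1" | "t * (1 - t) \<noteq> 0" by fastforce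
    then show False
    proof cases
      case 3
      then have "h x = h y" using eq by (auto simp: arc_path_def)
      then have "u x = v x" "u y = v y" using assms(3) xy by auto
      then show False using eq uv by (auto simp: arc_path_def algebra_simps)
    qed (use eq uv in \<open>auto simp: arc_path_def\<close>)
  qed
  then show ?thesis by (auto simp: path_image_def F_omega_def)
qed

text \<open>
  Arcs realize every permutation by a braid, so a product of commutators of permutations lifts to a
  product of commutators of braids. As composition of braids reverses composition of permutations, the
  commutator of \<open>a\<close> and \<open>b\<close> is obtained from braids with permutations \<open>b\<^sup>-\<^sup>1\<close> and \<open>a\<^sup>-\<^sup>1\<close>.
\<close>

lemma derived_surj_on_perms:
  assumes "bij \<sigma>"
  shows "\<exists>f. is_braid f \<sigma> \<and> braid_class f \<in> derived braid_group (carrier braid_group)" (is "?P \<sigma>")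
proof (rule perm_commutator_induct[where P = ?P, OF _ _ assms])
  fix a b :: "nat \<Rightarrow> nat" assume "?P a" "?P b"
  then obtain f g where fg: "is_braid f a" "is_braid g b"
    "braid_class f \<in> derived braid_group (carrier braid_group)"
    "braid_class g \<in> derived braid_group (carrier braid_group)" by auto
  have "braid_class g \<otimes>\<^bsub>braid_group\<^esub> braid_class f \<in> derived braid_group (carrier braid_group)"
    using B.derived_is_subgroup[of "carrier braid_group"] fg by (auto simp: subgroup_def)
  then have "braid_class (g +++ relabel b f) \<in> derived braid_group (carrier braid_group)"
    using fg by (simp add: braid_class_mult)
  then show "?P (a \<circ> b)" using is_braid_join[OF fg(2,1)] by blast
next
  fix a b :: "nat \<Rightarrow> nat" assume ab: "bij a" "bij b"
  have *: "\<exists>f. is_braid f \<tau>" if "bij \<tau>" for \<tau>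
  proof -
    have "is_braid (arc_path real (real \<circ> \<tau>) real) \<tau>"
      using that path_image_arc_path[of real "real \<circ> \<tau>" real] inj_compose[OF inj_of_nat bij_is_inj[OF that]]
      by (simp add: is_braid_def fun_eq_iff inj_of_nat)
    then show ?thesis by blast
  qed
  obtain f g where fg: "is_braid f (inv_into UNIV b)" "is_braid g (inv_into UNIV a)"
    using *[of "inv_into UNIV b"] *[of "inv_into UNIV a"] ab bij_imp_bij_inv by blast
  let ?f = "relabel (inv_into UNIV (inv_into UNIV b)) (reversepath f)"
  let ?g = "relabel (inv_into UNIV (inv_into UNIV a)) (reversepath g)"
  have b': "is_braid ?f b" "is_braid ?g a"
    using is_braid_inverse[OF fg(1)] is_braid_inverse[OF fg(2)] ab by (simp_all add: inv_inv_eq)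
  let ?h = "((f +++ relabel (inv_into UNIV b) g) +++ relabel (inv_into UNIV a \<circ> inv_into UNIV b) ?f)
     +++ relabel (b \<circ> (inv_into UNIV a \<circ> inv_into UNIV b)) ?g"
  note j = is_braid_join[OF fg] is_braid_join[OF is_braid_join[OF fg] b'(1)]
    is_braid_join[OF is_braid_join[OF is_braid_join[OF fg] b'(1)] b'(2)]
  have "braid_class f \<otimes>\<^bsub>braid_group\<^esub> braid_class g \<otimes>\<^bsub>braid_group\<^esub> inv\<^bsub>braid_group\<^esub> braid_class f
      \<otimes>\<^bsub>braid_group\<^esub> inv\<^bsub>braid_group\<^esub> braid_class g = braid_class ?h"
    using fg b' j by (simp only: braid_class_inverse braid_class_mult)
  moreover have "braid_class f \<in> carrier braid_group" "braid_class g \<in> carrier braid_group"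
    using fg braid_group_carrier by blast+
  ultimately have "braid_class ?h \<in> derived braid_group (carrier braid_group)"
    unfolding derived_def by (intro generate.incl) blast
  moreover have "is_braid ?h (a \<circ> b \<circ> inv_into UNIV a \<circ> inv_into UNIV b)"
    using j(3) by (simp only: comp_assoc)
  ultimately show "?P (a \<circ> b \<circ> inv_into UNIV a \<circ> inv_into UNIV b)" by blast
qed

lemma homotopic_paths_cancel:
  fixes p :: "real \<Rightarrow> 'a::topological_space"
  assumes "path h" "path_image h \<subseteq> X" "path p" "path_image p \<subseteq> X" "path k" "path_image k \<subseteq> X"
    "pathfinish h = pathfinish p" "pathfinish p = pathstart k"
  shows "homotopic_paths X ((h +++ reversepath p) +++ (p +++ k)) (h +++ k)"
proof -
  have 1: "homotopic_paths X ((h +++ reversepath p) +++ (p +++ k)) (h +++ (reversepath p +++ (p +++ k)))"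
    using assms by (intro homotopic_paths_sym[OF homotopic_paths_assoc] subset_path_image_join)
      (simp_all add: path_image_reversepath)
  have "homotopic_paths X (reversepath p +++ (p +++ k)) ((reversepath p +++ p) +++ k)"
    using assms by (intro homotopic_paths_assoc) (simp_all add: path_image_reversepath)
  moreover have "homotopic_paths X ((reversepath p +++ p) +++ k) ((\<lambda>_. pathfinish p) +++ k)"
    using assms homotopic_paths_join_reverse[of "reversepath p" X]
    by (intro homotopic_paths_join) (auto simp: path_image_reversepath)
  moreover have "homotopic_paths X ((\<lambda>_. pathfinish p) +++ k) k"
    using assms by (intro homotopic_paths_const_join) auto
  ultimately have "homotopic_paths X (reversepath p +++ (p +++ k)) k"
    by (blast intro: homotopic_paths_trans)
  then have "homotopic_paths X (h +++ (reversepath p +++ (p +++ k))) (h +++ k)"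
    using assms by (intro homotopic_paths_join) simp_all
  with 1 show ?thesis by (rule homotopic_paths_trans)
qed

text \<open>
  Conjugation by a path \<open>\<gamma>\<close> from the standard configuration to \<open>w\<close>: it turns a motion \<open>h\<close> from \<open>w\<close> to
  \<open>w \<circ> \<tau>\<close> into a braid with permutation \<open>\<tau>\<close>. Explicit motions are easier to write down at a well spaced
  \<open>w\<close> than at the standard configuration.
\<close>

definition rebase :: "(real \<Rightarrow> nat \<Rightarrow> complex) \<Rightarrow> (nat \<Rightarrow> nat) \<Rightarrow> (real \<Rightarrow> nat \<Rightarrow> complex) \<Rightarrow> real \<Rightarrow> nat \<Rightarrow> complex" where
  "rebase \<gamma> \<tau> h = \<gamma> +++ (h +++ relabel \<tau> (reversepath \<gamma>))"

definition braid_at :: "(nat \<Rightarrow> complex) \<Rightarrow> (real \<Rightarrow> nat \<Rightarrow> complex) \<Rightarrow> (nat \<Rightarrow> nat) \<Rightarrow> bool" where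
  "braid_at w h \<tau> \<longleftrightarrow> path h \<and> path_image h \<subseteq> F_omega \<and> pathstart h = w \<and> bij \<tau> \<and> pathfinish h = w \<circ> \<tau>"

lemma is_braid_rebase:
  assumes "path \<gamma>" "path_image \<gamma> \<subseteq> F_omega" "pathstart \<gamma> = of_nat" "braid_at (pathfinish \<gamma>) h \<tau>"
  shows "is_braid (rebase \<gamma> \<tau> h) \<tau>"
proof -
  have "bij \<tau>" "path h" "path_image h \<subseteq> F_omega" "pathstart h = pathfinish \<gamma>"
      "pathfinish h = pathfinish \<gamma> \<circ> \<tau>"
    using assms(4) by (simp_all add: braid_at_def)
  moreover from this have "path_image (relabel \<tau> (reversepath \<gamma>)) \<subseteq> F_omega"
    using assms(2) by (intro path_image_relabel) (simp_all add: path_image_reversepath bij_is_inj)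
  ultimately show ?thesis
    unfolding is_braid_def rebase_def using assms(1-3)
    by (intro conjI subset_path_image_join) simp_all
qed

lemma rebase_homotopic:
  assumes "path \<gamma>" "path_image \<gamma> \<subseteq> F_omega" "braid_at (pathfinish \<gamma>) h \<tau>" "homotopic_paths F_omega h k"
  shows "homotopic_paths F_omega (rebase \<gamma> \<tau> h) (rebase \<gamma> \<tau> k)"
proof -
  have "bij \<tau>" "pathstart h = pathfinish \<gamma>" "pathfinish h = pathfinish \<gamma> \<circ> \<tau>"
    using assms(3) by (simp_all add: braid_at_def)
  moreover from this have "path_image (relabel \<tau> (reversepath \<gamma>)) \<subseteq> F_omega"
    using assms(2) by (intro path_image_relabel) (simp_all add: path_image_reversepath bij_is_inj)
  ultimately show ?thesis
    unfolding rebase_def using assms(1,2,4) by (intro homotopic_paths_join) simp_all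
qed

lemma rebase_mult:
  assumes \<gamma>: "path \<gamma>" "path_image \<gamma> \<subseteq> F_omega" "pathstart \<gamma> = of_nat"
    and h: "braid_at (pathfinish \<gamma>) h \<tau>" and k: "braid_at (pathfinish \<gamma>) k \<kappa>"
  shows "braid_class (rebase \<gamma> \<tau> h) \<otimes>\<^bsub>braid_group\<^esub> braid_class (rebase \<gamma> \<kappa> k)
    = braid_class (rebase \<gamma> (\<kappa> \<circ> \<tau>) (h +++ relabel \<tau> k))"
proof -
  note hk = h[unfolded braid_at_def] k[unfolded braid_at_def]
  define g1 where "g1 = relabel \<tau> \<gamma>"
  define g2 where "g2 = relabel (\<kappa> \<circ> \<tau>) (reversepath \<gamma>)"
  define k1 where "k1 = relabel \<tau> k"
  have inj: "inj \<tau>" "inj (\<kappa> \<circ> \<tau>)" using hk by (auto intro: bij_is_inj inj_compose)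
  have p: "path g1" "path_image g1 \<subseteq> F_omega" "path g2" "path_image g2 \<subseteq> F_omega"
      "path k1" "path_image k1 \<subseteq> F_omega"
    using \<gamma> hk path_image_relabel[OF \<gamma>(2) inj(1)] path_image_relabel[of "reversepath \<gamma>", OF _ inj(2)]
      path_image_relabel[of k, OF _ inj(1)]
    by (auto simp: g1_def g2_def k1_def path_image_reversepath simp del: relabel_simps(2))
  have e: "pathfinish g1 = pathfinish h" "pathstart k1 = pathfinish h" "pathfinish k1 = pathstart g2"
    using hk by (auto simp: g1_def g2_def k1_def comp_assoc)
  have "homotopic_paths F_omega ((h +++ reversepath g1) +++ (g1 +++ (k1 +++ g2))) (h +++ (k1 +++ g2))"
    using hk p e by (intro homotopic_paths_cancel subset_path_image_join) auto
  moreover have "homotopic_paths F_omega (h +++ (k1 +++ g2)) ((h +++ k1) +++ g2)"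
    using hk p e by (intro homotopic_paths_assoc) auto
  ultimately have 1: "homotopic_paths F_omega ((h +++ reversepath g1) +++ (g1 +++ (k1 +++ g2))) ((h +++ k1) +++ g2)"
    by (rule homotopic_paths_trans)
  have "homotopic_paths F_omega ((\<gamma> +++ (h +++ reversepath g1)) +++ (g1 +++ (k1 +++ g2)))
      (\<gamma> +++ ((h +++ reversepath g1) +++ (g1 +++ (k1 +++ g2))))"
    using \<gamma> hk p e
    by (intro homotopic_paths_sym[OF homotopic_paths_assoc] subset_path_image_join)
       (auto simp: path_image_reversepath g1_def)
  also have "homotopic_paths F_omega \<dots> (\<gamma> +++ ((h +++ k1) +++ g2))"
    using \<gamma> hk by (intro homotopic_paths_join 1) auto
  finally have "braid_class ((\<gamma> +++ (h +++ reversepath g1)) +++ (g1 +++ (k1 +++ g2)))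
     = braid_class (\<gamma> +++ ((h +++ k1) +++ g2))" by (rule braid_class_eqI)
  moreover have "braid_class (rebase \<gamma> \<tau> h) \<otimes>\<^bsub>braid_group\<^esub> braid_class (rebase \<gamma> \<kappa> k)
     = braid_class (rebase \<gamma> \<tau> h +++ relabel \<tau> (rebase \<gamma> \<kappa> k))"
    by (rule braid_class_mult[OF is_braid_rebase[OF \<gamma> h] is_braid_rebase[OF \<gamma> k]])
  ultimately show ?thesis by (simp add: rebase_def g1_def g2_def k1_def)
qed

section \<open>Realizing a finite pure braid in the commutator subgroup\<close>

text \<open>
  Strand \<open>x\<close> is the copy of strand \<open>x mod n\<close> in block \<open>block n x\<close>; the blocks are indexed by the integers,
  and block \<open>0\<close> consists of the first \<open>n\<close> strands.
\<close>

definition block :: "nat \<Rightarrow> nat \<Rightarrow> int" where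
  "block n x = int_decode (x div n)"

definition shift_block :: "nat \<Rightarrow> int \<Rightarrow> nat \<Rightarrow> nat" where
  "shift_block n k x = n * int_encode (block n x + k) + x mod n"

lemma shift_block_simps [simp]:
  assumes "n > 0"
  shows "block n (shift_block n k x) = block n x + k" "shift_block n k x mod n = x mod n"
  using assms by (simp_all add: shift_block_def block_def)

lemma block_mod_eqI:
  assumes "block n x = block n y" "x mod n = y mod n"
  shows "x = y"
proof -
  have "x div n = y div n" using assms(1) by (metis block_def int_decode_inverse)
  then show ?thesis using assms(2) by (metis div_mult_mod_eq)
qed

lemma bij_shift_block: "n > 0 \<Longrightarrow> bij (shift_block n k)"
  by (rule o_bij[of "shift_block n (- k)"])
    (simp_all add: fun_eq_iff, (rule allI, rule block_mod_eqI[of n], simp_all)+)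

lemma block_less [simp]: "x < n \<Longrightarrow> block n x = 0"
  by (simp add: block_def int_decode_def sum_decode_def)

text \<open>
  Block \<open>j\<close> shows the first \<open>n\<close> points of \<open>f\<close> at its own time \<open>r j\<close>, translated by \<open>j L\<close>. With \<open>L\<close> larger than
  twice the size of the motion, different blocks never meet, whatever the times are.
\<close>

definition block_config :: "nat \<Rightarrow> nat \<Rightarrow> (real \<Rightarrow> nat \<Rightarrow> complex) \<Rightarrow> (int \<Rightarrow> real) \<Rightarrow> nat \<Rightarrow> complex" where
  "block_config n L f r x = f (r (block n x)) (x mod n) + of_int (int L * block n x)"

lemma block_config_in_F_omega:
  assumes n: "n > 0" and f: "path_image f \<subseteq> F_omega" and r: "\<And>j. r j \<in> {0..1}"
    and R: "\<And>t i. t \<in> {0..1} \<Longrightarrow> i < n \<Longrightarrow> norm (f t i) \<le> R" and L: "2 * R < real L"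
  shows "block_config n L f r \<in> F_omega"
  unfolding F_omega_def
proof (intro CollectI allI impI)
  fix x y :: nat assume "x \<noteq> y"
  let ?a = "f (r (block n x)) (x mod n)" and ?b = "f (r (block n y)) (y mod n)"
  show "block_config n L f r x \<noteq> block_config n L f r y"
  proof (cases "block n x = block n y")
    case True
    then have "x mod n \<noteq> y mod n" using block_mod_eqI \<open>x \<noteq> y\<close> by blast
    moreover have "f (r (block n x)) \<in> F_omega" using f r by (auto simp: path_image_def)
    ultimately show ?thesis using True by (auto simp: block_config_def F_omega_def)
  next
    case False
    have "norm (?a - ?b) \<le> norm ?a + norm ?b" by (rule norm_triangle_ineq4)
    also have "\<dots> \<le> R + R" using n r by (intro add_mono R) auto
    finally have *: "norm (?a - ?b) < real L" using L by simp
    have "1 \<le> \<bar>block n y - block n x\<bar>" using False by linarith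
    then have "real L * 1 \<le> real L * real_of_int \<bar>block n y - block n x\<bar>" by (intro mult_left_mono) auto
    also have "\<dots> = norm (of_int (int L * (block n y - block n x)) :: complex)"
      unfolding norm_of_int by (simp add: abs_mult)
    finally have **: "real L \<le> norm (of_int (int L * (block n y - block n x)) :: complex)" by simp
    show ?thesis
    proof
      assume "block_config n L f r x = block_config n L f r y"
      then have "?a - ?b = of_int (int L * (block n y - block n x))"
        by (simp add: block_config_def algebra_simps)
      then show False using * ** by simp
    qed
  qed
qed

lemma continuous_on_block_config:
  fixes r :: "'a::topological_space \<Rightarrow> int \<Rightarrow> real"
  assumes f: "path f" and r: "\<And>j. continuous_on A (\<lambda>z. r z j)" "\<And>z j. z \<in> A \<Longrightarrow> r z j \<in> {0..1}"
  shows "continuous_on A (\<lambda>z. block_config n L f (r z))"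
proof (rule continuous_on_coordinatewise_then_product)
  fix x
  have "continuous_on {0..1} (\<lambda>t. f t (x mod n))"
    using f unfolding path_coordinatewise path_def by blast
  then have "continuous_on A (\<lambda>z. f (r z (block n x)) (x mod n))"
    by (rule continuous_on_compose2) (use r in auto)
  then show "continuous_on A (\<lambda>z. block_config n L f (r z) x)"
    unfolding block_config_def by (intro continuous_on_add continuous_on_const)
qed

text \<open>
  The points beyond the first \<open>n\<close> are unconstrained and can be moved along straight lines.
\<close>

lemma homotopic_in_F_first:
  assumes "path f" "path g" "path_image f \<subseteq> F_first n" "f 0 = g 0" "f 1 = g 1"
    and eq: "\<And>t i. t \<in> {0..1} \<Longrightarrow> i < n \<Longrightarrow> f t i = g t i"
  shows "homotopic_paths (F_first n) f g"
proof -
  define K where "K z x = of_real (1 - fst z) * f (snd z) x + of_real (fst z) * g (snd z) x" for z :: "real \<times> real" and x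
  have c: "continuous_on ({0..1} \<times> {0..1}) (\<lambda>z. h (snd z) x)" if "path h" for h :: "real \<Rightarrow> nat \<Rightarrow> complex" and x
  proof -
    have "continuous_on {0..1} (\<lambda>t. h t x)" using that unfolding path_coordinatewise path_def by blast
    then show ?thesis by (rule continuous_on_compose2) (auto intro: continuous_on_snd continuous_on_id)
  qed
  have "continuous_on ({0..1} \<times> {0..1}) K"
    by (rule continuous_on_coordinatewise_then_product, unfold K_def,
        intro continuous_on_add continuous_on_mult continuous_on_of_real continuous_on_diff
          continuous_on_const continuous_on_fst continuous_on_id c assms)
  moreover have "K (s, t) \<in> F_first n" if "t \<in> {0..1}" for s t
  proof -
    have "K (s, t) i = f t i" if "i < n" for i
      using eq[OF \<open>t \<in> {0..1}\<close> that] by (simp add: K_def algebra_simps)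
    moreover have "f t \<in> F_first n" using assms(3) that by (auto simp: path_image_def)
    ultimately show ?thesis by (auto simp: F_first_def inj_on_def)
  qed
  moreover have "K (0, t) = f t" "K (1, t) = g t" "K (s, 0) = f 0" "K (s, 1) = f 1" for s t
    using assms(4,5) by (auto simp: K_def fun_eq_iff algebra_simps)
  ultimately show ?thesis
    unfolding homotopic_paths by (intro exI[of _ K]) (auto simp: pathstart_def pathfinish_def)
qed

text \<open>
  The algebra of the swindle: \<open>p = s s'\<^sup>-\<^sup>1\<close> and \<open>s' = t s t\<^sup>-\<^sup>1\<close>.
\<close>

lemma commutator_eqI:
  assumes "group G" "p \<in> carrier G" "s \<in> carrier G" "s' \<in> carrier G" "t \<in> carrier G"
    "p \<otimes>\<^bsub>G\<^esub> s' = s" "s' \<otimes>\<^bsub>G\<^esub> t = t \<otimes>\<^bsub>G\<^esub> s"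
  shows "p \<in> derived G (carrier G)"
proof -
  interpret group G by fact
  have "s' = t \<otimes>\<^bsub>G\<^esub> s \<otimes>\<^bsub>G\<^esub> inv\<^bsub>G\<^esub> t" using assms by (metis inv_solve_right m_closed)
  then have "p = s \<otimes>\<^bsub>G\<^esub> inv\<^bsub>G\<^esub> (t \<otimes>\<^bsub>G\<^esub> s \<otimes>\<^bsub>G\<^esub> inv\<^bsub>G\<^esub> t)" using assms by (metis inv_solve_right)
  also have "\<dots> = s \<otimes>\<^bsub>G\<^esub> t \<otimes>\<^bsub>G\<^esub> inv\<^bsub>G\<^esub> s \<otimes>\<^bsub>G\<^esub> inv\<^bsub>G\<^esub> t"
    using assms by (simp add: inv_mult_group m_assoc)
  finally show ?thesis using assms unfolding derived_def by (intro generate.incl) blast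
qed

text \<open>
  The swindle on braids. At the base configuration \<open>w\<close>, in which all blocks are at rest, \<open>P\<close> performs \<open>f\<close> in
  block \<open>0\<close>, \<open>S'\<close> in all blocks \<open>j \<ge> 1\<close>, and \<open>S\<close> in all blocks \<open>j \<ge> 0\<close>; \<open>T\<close> translates everything by
  \<open>-L\<close>, which moves each block onto its predecessor. Since \<open>P\<close> and \<open>S'\<close> move different blocks,
  \<open>P \<cdot> S' \<sim> S\<close>. Since \<open>S'\<close> translated by \<open>-L\<close> is \<open>S\<close>, relabelled, \<open>S' \<cdot> T \<sim> T \<cdot> S\<close>. Hence
  the class of \<open>P\<close>, conjugated to the standard configuration, is a commutator.
\<close>

lemma first_strands_realized_in_derived:
  assumes f: "is_braid f id" and n: "n > 0"
  shows "\<exists>d. is_braid d id \<and> braid_class d \<in> derived braid_group (carrier braid_group)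
    \<and> homotopic_paths (F_first n) f d"
proof -
  note f' = is_braidD[OF f]
  have f0: "f 0 = of_nat" "f 1 = of_nat" using f'(3,4) by (simp_all add: pathstart_def pathfinish_def)
  have "\<exists>R. \<forall>i<n. \<forall>t\<in>{0..1}. norm (f t i) \<le> R"
  proof -
    have "\<exists>R. \<forall>t\<in>{0..1}. norm (f t i) \<le> R" for i
    proof -
      have "path (\<lambda>t. f t i)" using f'(1) path_coordinatewise by blast
      then have "bounded ((\<lambda>t. f t i) ` {0..1})" using bounded_path_image by (auto simp: path_image_def)
      then show ?thesis by (auto simp: bounded_iff)
    qed
    then obtain R where R: "\<And>i. \<forall>t\<in>{0..1}. norm (f t i) \<le> R i" by metis
    show ?thesis
    proof (intro exI allI impI ballI)
      fix i t assume "i < n" "t \<in> {0..1::real}"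
      then have "norm (f t i) \<le> R i" "R i \<le> Max (R ` {..<n})" using R[of i] by auto
      then show "norm (f t i) \<le> Max (R ` {..<n})" by (rule order_trans)
    qed
  qed
  then obtain R where R: "\<And>t i. t \<in> {0..1} \<Longrightarrow> i < n \<Longrightarrow> norm (f t i) \<le> R" by blast
  obtain L where L: "2 * R < real L" using reals_Archimedean2 by blast
  let ?C = "block_config n L f"
  have C: "?C r \<in> F_omega" if "\<And>j. r j \<in> {0..1}" for r
    using block_config_in_F_omega[OF n f'(2) that R L] .
  define w where "w = ?C (\<lambda>_. 0)"
  have w: "?C (\<lambda>j. if p j then 1 else 0) = w" for p
    by (auto simp: w_def block_config_def fun_eq_iff f0)
  \<comment> \<open>The time of block \<open>0\<close> is the first parameter, that of the blocks \<open>j \<ge> 1\<close> is the second.\<close>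
  define r where "r z j = (if j = 0 then fst z else if j > 0 then snd z else 0)" for z :: "real \<times> real" and j :: int
  define \<Phi> where "\<Phi> z = ?C (r z)" for z
  have r01: "r z j \<in> {0..1}" if "z \<in> {0..1} \<times> {0..1}" for z j using that by (auto simp: r_def)
  have rc: "continuous_on A (\<lambda>z. r z j)" for A j
    unfolding r_def by (cases "j = 0"; cases "j > 0")
      (simp_all add: continuous_on_fst continuous_on_snd continuous_on_id)
  have \<Phi>: "continuous_on ({0..1} \<times> {0..1}) \<Phi>" "\<And>z. z \<in> {0..1} \<times> {0..1} \<Longrightarrow> \<Phi> z \<in> F_omega"
  proof -
    show "continuous_on ({0..1} \<times> {0..1}) \<Phi>"
      unfolding \<Phi>_def by (rule continuous_on_block_config[OF f'(1) rc r01])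
    show "\<Phi> z \<in> F_omega" if "z \<in> {0..1} \<times> {0..1}" for z
      unfolding \<Phi>_def by (rule C[OF r01[OF that]])
  qed
  have \<Phi>w: "\<Phi> (0, 0) = w" "\<Phi> (1, 0) = w" "\<Phi> (0, 1) = w" "\<Phi> (1, 1) = w"
    unfolding \<Phi>_def r_def using w[of "\<lambda>j. False"] w[of "\<lambda>j. j = 0"] w[of "\<lambda>j. j > 0"] w[of "\<lambda>j. j \<ge> 0"]
    by (auto simp: w_def block_config_def fun_eq_iff f0)
  have \<Phi>1: "\<Phi> (1, t) = \<Phi> (0, t)" for t
    by (auto simp: \<Phi>_def r_def block_config_def fun_eq_iff f0)
  define P where "P t = \<Phi> (t, 0)" for t
  define S where "S t = \<Phi> (t, t)" for t
  define S' where "S' t = \<Phi> (0, t)" for t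
  define T where "T t x = w x - of_real (real L * t)" for t x
  define \<Psi> where "\<Psi> z x = \<Phi> (0, fst z) x - of_real (real L * snd z)" for z x
  have at: "braid_at w P id" "braid_at w S id" "braid_at w S' id"
  proof -
    have "path P" "path S" "path S'"
      unfolding P_def S_def S'_def
      using continuous_square_path[OF \<Phi>(1), of "\<lambda>t. t" "\<lambda>t. 0"] continuous_square_path[OF \<Phi>(1), of "\<lambda>t. t" "\<lambda>t. t"]
        continuous_square_path[OF \<Phi>(1), of "\<lambda>t. 0" "\<lambda>t. t"] by (simp_all add: continuous_on_id)
    then show "braid_at w P id" "braid_at w S id" "braid_at w S' id"
      using \<Phi>(2) \<Phi>w by (auto simp: braid_at_def P_def S_def S'_def pathstart_def pathfinish_def path_image_def)
  qed
  have "homotopic_paths F_omega ((\<lambda>t. \<Phi> (t, 0)) +++ (\<lambda>t. \<Phi> (1, t))) (\<lambda>t. \<Phi> (t, t))"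
    by (rule homotopic_paths_square[OF \<Phi>])
  then have PS: "homotopic_paths F_omega (P +++ S') S" unfolding P_def S_def S'_def \<Phi>1 .
  have \<Psi>in: "\<Psi> z \<in> F_omega" if "z \<in> {0..1} \<times> {0..1}" for z
    using \<Phi>(2)[of "(0, fst z)"] that by (auto simp: \<Psi>_def F_omega_def)
  have \<Psi>c: "continuous_on ({0..1} \<times> {0..1}) \<Psi>"
  proof (rule continuous_on_coordinatewise_then_product)
    fix x
    have "continuous_on ({0..1} \<times> {0..1}) (\<lambda>z::real \<times> real. (0::real, fst z))"
      by (intro continuous_on_Pair continuous_on_const continuous_on_fst continuous_on_id)
    then have "continuous_on ({0..1} \<times> {0..1}) (\<lambda>z::real \<times> real. \<Phi> (0, fst z) x)"
      by (rule continuous_on_compose2[OF continuous_on_product_then_coordinatewise[OF \<Phi>(1), of x]]) auto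
    then show "continuous_on ({0..1} \<times> {0..1}) (\<lambda>z. \<Psi> z x)"
      unfolding \<Psi>_def by (intro continuous_on_diff continuous_on_of_real continuous_on_mult
          continuous_on_const continuous_on_snd continuous_on_id)
  qed
  let ?\<tau> = "shift_block n (- 1)"
  have "(\<lambda>t. \<Psi> (t, 0)) = S'" "(\<lambda>t. \<Psi> (1, t)) = T" "(\<lambda>t. \<Psi> (0, t)) = T"
    by (auto simp: \<Psi>_def S'_def T_def fun_eq_iff \<Phi>w)
  note \<Psi>e = this
  have \<Psi>1: "(\<lambda>t. \<Psi> (t, 1)) = relabel ?\<tau> S"
    using n by (auto simp: \<Psi>_def S_def \<Phi>_def r_def block_config_def relabel_def fun_eq_iff f0 algebra_simps)
  have ST: "homotopic_paths F_omega (S' +++ T) (T +++ relabel ?\<tau> S)"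
    using homotopic_paths_square(2)[OF \<Psi>c \<Psi>in] unfolding \<Psi>e \<Psi>1 .
  have "path (\<lambda>t. \<Psi> (0, t))"
    using continuous_square_path[OF \<Psi>c, of "\<lambda>t. 0" "\<lambda>t. t"] by (simp add: continuous_on_id)
  then have "path T" unfolding \<Psi>e .
  moreover have "T t \<in> F_omega" if "t \<in> {0..1}" for t
    using \<Psi>in[of "(0, t)"] that fun_cong[OF \<Psi>e(3), of t] by simp
  moreover have "T 1 = w \<circ> ?\<tau>" "T 0 = w"
    using n by (auto simp: T_def w_def block_config_def fun_eq_iff algebra_simps)
  ultimately have Tat: "braid_at w T ?\<tau>"
    unfolding braid_at_def using bij_shift_block[OF n]
    by (auto simp: pathstart_def pathfinish_def path_image_def)

  define wr where "wr x = real (x mod n) + real L * of_int (block n x)" for x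
  have wr: "w x = of_real (wr x)" for x by (simp add: w_def block_config_def wr_def f0)
  have "w \<in> F_omega" using \<Phi>(2)[of "(0, 0)"] by (simp add: \<Phi>w)
  then have "inj wr" by (auto simp: F_omega_def inj_def wr)
  \<comment> \<open>The arcs have level \<open>0\<close> exactly for \<open>x < n\<close>, so the conjugating path leaves the first \<open>n\<close> strands alone.\<close>
  define \<gamma> where "\<gamma> = arc_path real wr (\<lambda>x. if x < n then 0 else real x)"
  have wr_n: "wr x = real x" if "x < n" for x using that by (simp add: wr_def)
  have \<gamma>: "path \<gamma>" "path_image \<gamma> \<subseteq> F_omega" "pathstart \<gamma> = of_nat" "pathfinish \<gamma> = w"
  proof -
    have "real x = wr x \<and> real y = wr y"
      if "x \<noteq> y" "(if x < n then 0 else real x) = (if y < n then 0 else real y)" for x y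
      using that n by (auto simp: wr_n split: if_splits)
    then show "path_image \<gamma> \<subseteq> F_omega"
      unfolding \<gamma>_def using \<open>inj wr\<close> by (intro path_image_arc_path inj_of_nat) blast+
  qed (simp_all add: \<gamma>_def fun_eq_iff wr)
  have \<gamma>_n: "\<gamma> t x = of_nat x" if "x < n" for t x
    using that by (simp add: \<gamma>_def arc_path_def wr_n algebra_simps complex_eq_iff)
  let ?p = "braid_class (rebase \<gamma> id P)"
  let ?s = "braid_class (rebase \<gamma> id S)"
  let ?s' = "braid_class (rebase \<gamma> id S')"
  let ?t = "braid_class (rebase \<gamma> ?\<tau> T)"
  have br: "is_braid (rebase \<gamma> id P) id" "is_braid (rebase \<gamma> id S) id" "is_braid (rebase \<gamma> id S') id"
      "is_braid (rebase \<gamma> ?\<tau> T) ?\<tau>"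
    using at Tat by (auto intro!: is_braid_rebase \<gamma> simp: \<gamma>)
  have PS_at: "braid_at w (P +++ S') id" "braid_at w (S' +++ T) ?\<tau>"
    using at Tat unfolding braid_at_def by (simp_all add: subset_path_image_join)
  have p: "?p \<in> derived braid_group (carrier braid_group)"
  proof (rule commutator_eqI[OF group_braid_group, where s = ?s and s' = ?s' and t = ?t])
    show "?p \<in> carrier braid_group" "?s \<in> carrier braid_group" "?s' \<in> carrier braid_group"
        "?t \<in> carrier braid_group" using br braid_group_carrier by blast+
    have "?p \<otimes>\<^bsub>braid_group\<^esub> ?s' = braid_class (rebase \<gamma> (id \<circ> id) (P +++ relabel id S'))"
      using at by (intro rebase_mult \<gamma>) (simp_all add: \<gamma>)
    also have "\<dots> = braid_class (rebase \<gamma> id (P +++ S'))" by simp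
    also have "\<dots> = ?s"
      using PS_at by (intro braid_class_eqI rebase_homotopic \<gamma> PS) (simp add: \<gamma>)
    finally show "?p \<otimes>\<^bsub>braid_group\<^esub> ?s' = ?s" .
    have "?s' \<otimes>\<^bsub>braid_group\<^esub> ?t = braid_class (rebase \<gamma> (?\<tau> \<circ> id) (S' +++ relabel id T))"
      using at Tat by (intro rebase_mult \<gamma>) (simp_all add: \<gamma>)
    also have "\<dots> = braid_class (rebase \<gamma> ?\<tau> (S' +++ T))" by simp
    also have "\<dots> = braid_class (rebase \<gamma> ?\<tau> (T +++ relabel ?\<tau> S))"
      using PS_at by (intro braid_class_eqI rebase_homotopic \<gamma> ST) (simp add: \<gamma>)
    also have "\<dots> = braid_class (rebase \<gamma> (id \<circ> ?\<tau>) (T +++ relabel ?\<tau> S))" by simp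
    also have "\<dots> = ?t \<otimes>\<^bsub>braid_group\<^esub> ?s"
      using at Tat by (intro rebase_mult[symmetric] \<gamma>) (simp_all add: \<gamma>)
    finally show "?s' \<otimes>\<^bsub>braid_group\<^esub> ?t = ?t \<otimes>\<^bsub>braid_group\<^esub> ?s" .
  qed
  let ?c = "\<lambda>_::real. of_nat :: nat \<Rightarrow> complex"
  have f_first: "path_image f \<subseteq> F_first n" using f'(2) F_omega_subset_F_first by blast
  have c_first: "path_image ?c \<subseteq> F_first n" "path ?c"
    using is_braidD(1,2)[OF is_braid_id] F_omega_subset_F_first by blast+
  have P_n: "P t x = f t x" if "x < n" for t x
    using that by (simp add: P_def \<Phi>_def r_def block_config_def)
  \<comment> \<open>On the first \<open>n\<close> strands the conjugate of \<open>P\<close> is \<open>f\<close> preceded and followed by a rest.\<close>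
  have "homotopic_paths (F_first n) (?c +++ (f +++ ?c)) (f +++ ?c)"
    using f_first c_first f'(1) f0 by (intro homotopic_paths_const_join subset_path_image_join path_join_imp)
      (simp_all add: pathstart_def pathfinish_def joinpaths_def)
  moreover have "homotopic_paths (F_first n) (reversepath (?c +++ reversepath f)) (reversepath (reversepath f))"
    using f_first f' unfolding homotopic_paths_reversepath
    by (intro homotopic_paths_const_join) (auto simp: path_image_reversepath)
  moreover have "reversepath (?c +++ reversepath f) = f +++ ?c"
    using f' by (subst reversepath_joinpaths) (auto simp: pathstart_def pathfinish_def reversepath_def)
  ultimately have "homotopic_paths (F_first n) f (?c +++ (f +++ ?c))"
    using homotopic_paths_sym homotopic_paths_trans by fastforce
  moreover have "homotopic_paths (F_first n) (?c +++ (f +++ ?c)) (rebase \<gamma> id P)"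
  proof (rule homotopic_in_F_first)
    show "path (?c +++ (f +++ ?c))" "path_image (?c +++ (f +++ ?c)) \<subseteq> F_first n"
      using f_first c_first f'(1) f0
      by (intro subset_path_image_join path_join_imp; simp add: pathstart_def pathfinish_def joinpaths_def)+
    show "path (rebase \<gamma> id P)" using is_braidD[OF br(1)] by simp
    show "(?c +++ (f +++ ?c)) 0 = rebase \<gamma> id P 0" "(?c +++ (f +++ ?c)) 1 = rebase \<gamma> id P 1"
      using is_braidD(3,4)[OF br(1)] by (simp_all add: pathstart_def pathfinish_def joinpaths_def)
    show "(?c +++ (f +++ ?c)) t i = rebase \<gamma> id P t i" if "i < n" for t i
      using that by (simp add: rebase_def joinpaths_def reversepath_def P_n \<gamma>_n)
  qed
  ultimately have "homotopic_paths (F_first n) f (rebase \<gamma> id P)" by (rule homotopic_paths_trans)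
  then show ?thesis using p br(1) by blast
qed

section \<open>Representatives that fix the first strands\<close>

text \<open>
  Divide first by an element of the commutator subgroup with the same permutation, then by one with the
  same first \<open>n\<close> strands up to homotopy. What remains is null-homotopic on the first \<open>n\<close> strands, and
  lifting the null-homotopy makes them constant.
\<close>

lemma class_represented_by_pure_braid_fixing_first_strands:
  assumes X: "X \<in> carrier braid_group" and n: "n > 0"
  shows "\<exists>\<beta> d. is_braid \<beta> id \<and> (\<forall>t\<in>{0..1}. \<forall>i<n. \<beta> t i = of_nat i)
    \<and> d \<in> derived braid_group (carrier braid_group) \<and> X = braid_class \<beta> \<otimes>\<^bsub>braid_group\<^esub> d"
proof -
  let ?D = "derived braid_group (carrier braid_group)"
  interpret D: subgroup ?D braid_group by (rule B.derived_is_subgroup) simp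
  have Dc: "x \<in> carrier braid_group" if "x \<in> ?D" for x using that by (rule D.mem_carrier)
  obtain g \<sigma> where g: "is_braid g \<sigma>" "X = braid_class g" using X braid_group_carrier by blast
  obtain c where c: "is_braid c \<sigma>" "braid_class c \<in> ?D"
    using derived_surj_on_perms is_braidD(5)[OF g(1)] by blast
  define f where "f = g +++ relabel \<sigma> (relabel (inv_into UNIV \<sigma>) (reversepath c))"
  have "inv_into UNIV \<sigma> \<circ> \<sigma> = id" using is_braidD(6)[OF g(1)] by simp
  then have f: "is_braid f id"
    using is_braid_join[OF g(1) is_braid_inverse[OF c(1)]] by (simp only: f_def)
  have Xf: "X \<otimes>\<^bsub>braid_group\<^esub> inv\<^bsub>braid_group\<^esub> braid_class c = braid_class f"
    unfolding f_def g(2) braid_class_inverse[OF c(1)]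
    by (rule braid_class_mult[OF g(1) is_braid_inverse[OF c(1)]])
  obtain d where d: "is_braid d id" "braid_class d \<in> ?D" "homotopic_paths (F_first n) f d"
    using first_strands_realized_in_derived[OF f n] by blast
  note fD = is_braidD[OF f] and dD = is_braidD[OF d(1)]
  have first: "path_image d \<subseteq> F_first n" using dD(2) F_omega_subset_F_first by blast
  have "homotopic_paths (F_first n) (f +++ reversepath d) (d +++ reversepath d)"
    using d(3) first dD(1) fD(4) dD(4)
    by (intro homotopic_paths_join) (simp_all add: path_image_reversepath)
  also have "homotopic_paths (F_first n) \<dots> (\<lambda>_. of_nat)"
    using homotopic_paths_join_reverse[OF dD(1) first] dD(3) by simp
  finally have null: "homotopic_paths (F_first n) (f +++ reversepath d) (\<lambda>_. of_nat)" .
  have "inv_into UNIV id = (id :: nat \<Rightarrow> nat)" by simp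
  then have inv_d: "is_braid (reversepath d) id" "inv\<^bsub>braid_group\<^esub> braid_class d = braid_class (reversepath d)"
    using is_braid_inverse[OF d(1)] braid_class_inverse[OF d(1)] by simp_all
  have fd: "is_braid (f +++ reversepath d) id" using is_braid_join[OF f inv_d(1)] by simp
  obtain \<beta> where \<beta>: "homotopic_paths F_omega (f +++ reversepath d) \<beta>"
     "\<forall>t\<in>{0..1}. \<forall>i<n. \<beta> t i = of_nat i"
    using lift_homotopy_of_first_strands[OF is_braidD(1,2)[OF fd] null] by blast
  have \<beta>_braid: "is_braid \<beta> id" using is_braid_homotopic[OF fd \<beta>(1)] .
  have cl: "braid_class \<beta> \<in> carrier braid_group" "braid_class d \<in> carrier braid_group"
     "braid_class c \<in> carrier braid_group" "braid_class f \<in> carrier braid_group"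
    using \<beta>_braid d(1) c(1) f braid_group_carrier by blast+
  have "braid_class \<beta> = braid_class f \<otimes>\<^bsub>braid_group\<^esub> inv\<^bsub>braid_group\<^esub> braid_class d"
    using braid_class_mult[OF f inv_d(1)] braid_class_eqI[OF \<beta>(1)] inv_d(2) by simp
  then have "braid_class f = braid_class \<beta> \<otimes>\<^bsub>braid_group\<^esub> braid_class d"
    using B.inv_solve_right[OF cl(1,4,2)] by blast
  moreover have "X = braid_class f \<otimes>\<^bsub>braid_group\<^esub> braid_class c"
    using B.inv_solve_right[OF cl(4) X cl(3)] Xf by simp
  ultimately have "X = braid_class \<beta> \<otimes>\<^bsub>braid_group\<^esub> (braid_class d \<otimes>\<^bsub>braid_group\<^esub> braid_class c)"
    using cl by (simp add: B.m_assoc)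
  moreover have "braid_class d \<otimes>\<^bsub>braid_group\<^esub> braid_class c \<in> ?D" using d(2) c(2) by (rule D.m_closed)
  ultimately show ?thesis using \<beta>_braid \<beta>(2) by blast
qed

section \<open>Infinitely nested braids\<close>

primrec loop_pow :: "nat \<Rightarrow> (real \<Rightarrow> 'a::topological_space) \<Rightarrow> real \<Rightarrow> 'a" where
  "loop_pow 0 f = (\<lambda>_. pathstart f)"
| "loop_pow (Suc k) f = f +++ loop_pow k f"

lemma loop_pow_ends [simp]:
  assumes "pathfinish f = pathstart f"
  shows "pathstart (loop_pow k f) = pathstart f" "pathfinish (loop_pow k f) = pathstart f"
  using assms by (induction k) (simp_all, simp_all add: pathstart_def pathfinish_def)

lemma path_loop_pow [simp]:
  assumes "path f" "pathfinish f = pathstart f"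
  shows "path (loop_pow k f)"
proof (induction k)
  case 0
  show ?case by (simp add: path_def)
next
  case (Suc k)
  then show ?case using assms by simp
qed

lemma joinpaths_coordinate: "(f +++ g) t x = ((\<lambda>s. f s x) +++ (\<lambda>s. g s x)) t"
  by (simp add: joinpaths_def)

lemma loop_pow_coordinate: "loop_pow k f t x = loop_pow k (\<lambda>s. f s x) t"
  by (induction k arbitrary: t) (simp_all add: pathstart_def joinpaths_def)

lemma joinpaths_pointwise:
  assumes "\<And>t. t \<in> {0..1} \<Longrightarrow> R (f t) (f' t)" "\<And>t. t \<in> {0..1} \<Longrightarrow> R (g t) (g' t)" "t \<in> {0..1}"
  shows "R ((f +++ g) t) ((f' +++ g') t)"
  using assms by (simp add: joinpaths_def)

lemma loop_pow_pointwise: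
  assumes "\<And>t. t \<in> {0..1} \<Longrightarrow> R (f t) (f' t)" "t \<in> {0..1}"
  shows "R (loop_pow k f t) (loop_pow k f' t)"
  using assms(2)
proof (induction k arbitrary: t)
  case 0
  then show ?case using assms(1)[of 0] by (simp add: pathstart_def)
next
  case (Suc k)
  then show ?case unfolding loop_pow.simps by (intro joinpaths_pointwise[where R = R] assms(1))
qed

lemma loop_pow_braid:
  assumes "is_braid f id"
  shows "is_braid (loop_pow k f) id \<and> braid_class (loop_pow k f) = braid_class f [^]\<^bsub>braid_group\<^esub> k"
proof (induction k)
  case 0
  have "loop_pow 0 f = (\<lambda>_. of_nat)" using is_braidD(3)[OF assms] by simp
  moreover have "braid_class f [^]\<^bsub>braid_group\<^esub> (0 :: nat) = braid_class (\<lambda>_. of_nat)"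
    by (simp add: braid_group_one)
  ultimately show ?case using is_braid_id by (simp only:)
next
  case (Suc k)
  have c: "braid_class f \<in> carrier braid_group" using assms braid_group_carrier by blast
  have "is_braid (f +++ loop_pow k f) id"
    using is_braid_join[OF assms conjunct1[OF Suc]] by (simp only: relabel_simps comp_id)
  moreover have "braid_class (f +++ loop_pow k f) = braid_class f \<otimes>\<^bsub>braid_group\<^esub> braid_class (loop_pow k f)"
    using braid_class_mult[OF assms conjunct1[OF Suc]] by simp
  ultimately show ?case
    unfolding loop_pow.simps B.nat_pow_Suc2[OF c] conjunct2[OF Suc] by (rule conjI)
qed

text \<open>
  The path of strand \<open>x\<close> in the infinitely nested braid \<open>Y\<^sub>n = \<beta>\<^sub>n \<cdot> Y\<^sub>n\<^sub>+\<^sub>1 \<cdot> \<dots> \<cdot> Y\<^sub>n\<^sub>+\<^sub>1\<close>. A single strand unfolds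
  only finitely often, because it rests in all \<open>\<beta>\<^sub>k\<close> with \<open>k > x\<close>.
\<close>

function nested_strand :: "(nat \<Rightarrow> real \<Rightarrow> nat \<Rightarrow> complex) \<Rightarrow> nat \<Rightarrow> nat \<Rightarrow> real \<Rightarrow> complex" where
  "nested_strand \<beta> x n = (if x < n then (\<lambda>_. of_nat x)
     else (\<lambda>t. \<beta> n t x) +++ loop_pow (n + 1) (nested_strand \<beta> x (n + 1)))"
  by auto
termination by (relation "Wellfounded.measure (\<lambda>(\<beta>, x, n). Suc x - n)") auto

declare nested_strand.simps [simp del]

text \<open>
  The unfolding equation holds for all strands at once, including those that already rest, so \<open>Y\<^sub>n\<close>
  equals a finite concatenation on the unit interval, which gives the recursion for the classes. Two
  strands \<open>x \<noteq> y\<close> never meet, by downward induction on \<open>n\<close>, starting where \<open>n\<close> exceeds both.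
\<close>

lemma nested_braid_exists:
  assumes \<beta>: "\<And>n. n > 0 \<Longrightarrow> is_braid (\<beta> n) id"
    and fixed: "\<And>n t i. n > 0 \<Longrightarrow> t \<in> {0..1} \<Longrightarrow> i < n \<Longrightarrow> \<beta> n t i = of_nat i"
  shows "\<exists>Y. \<forall>n>0. is_braid (Y n) id \<and> braid_class (Y n) =
    braid_class (\<beta> n) \<otimes>\<^bsub>braid_group\<^esub> braid_class (Y (n + 1)) [^]\<^bsub>braid_group\<^esub> (n + 1)"
proof -
  let ?N = "nested_strand \<beta>"
  have strand: "path (\<lambda>t. \<beta> n t x)" "\<beta> n 0 x = of_nat x" "\<beta> n 1 x = of_nat x" if "n > 0" for n x
    using is_braidD[OF \<beta>[OF that]] by (auto simp: path_coordinatewise pathstart_def pathfinish_def)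
  have N: "path (?N x n) \<and> pathstart (?N x n) = of_nat x \<and> pathfinish (?N x n) = of_nat x" if "n > 0" for x n
    using that
  proof (induction "Suc x - n" arbitrary: n rule: less_induct)
    case less
    show ?case
    proof (cases "x < n")
      case True
      then show ?thesis by (simp add: nested_strand.simps[of \<beta> x n] path_def pathstart_def pathfinish_def)
    next
      case False
      then have IH: "path (?N x (n + 1))" "pathstart (?N x (n + 1)) = of_nat x" "pathfinish (?N x (n + 1)) = of_nat x"
        using less by auto
      have "path (loop_pow (n + 1) (?N x (n + 1)))" "pathstart (loop_pow (n + 1) (?N x (n + 1))) = of_nat x"
        "pathfinish (loop_pow (n + 1) (?N x (n + 1))) = of_nat x"
        using IH by (simp_all del: loop_pow.simps)
      moreover have "?N x n = (\<lambda>t. \<beta> n t x) +++ loop_pow (n + 1) (?N x (n + 1))"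
        using False by (simp add: nested_strand.simps[of \<beta> x n])
      moreover have "pathstart (\<lambda>t. \<beta> n t x) = of_nat x" "pathfinish (\<lambda>t. \<beta> n t x) = of_nat x"
        using strand[OF less.prems] by (simp_all add: pathstart_def pathfinish_def)
      ultimately show ?thesis using strand(1)[OF less.prems] by simp
    qed
  qed
  have N_eq: "?N x n t = ((\<lambda>t. \<beta> n t x) +++ loop_pow (n + 1) (?N x (n + 1))) t"
    if "n > 0" "t \<in> {0..1}" for x n t
  proof (cases "x < n")
    case True
    have "?N x (n + 1) = (\<lambda>_. of_nat x)" using True by (simp add: nested_strand.simps)
    moreover have "loop_pow k (\<lambda>_. of_nat x :: complex) = (\<lambda>_. of_nat x)" for k
      by (induction k) (simp_all add: pathstart_def joinpaths_def fun_eq_iff)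
    moreover have "?N x n t = of_nat x" using True by (simp add: nested_strand.simps[of \<beta> x n])
    ultimately show ?thesis using True that fixed[OF that(1)] by (simp add: joinpaths_def del: loop_pow.simps)
  qed (simp add: nested_strand.simps[of \<beta> x n])
  have N_distinct: "?N x n t \<noteq> ?N y n t" if "n > 0" "t \<in> {0..1}" "x \<noteq> y" for x y n t
    using that(1,2)
  proof (induction "Suc (max x y) - n" arbitrary: n t rule: less_induct)
    case less
    show ?case
    proof (cases "max x y < n")
      case True
      then show ?thesis using that(3) by (simp add: nested_strand.simps[of \<beta> _ n])
    next
      case False
      have "?N x (n + 1) s \<noteq> ?N y (n + 1) s" if "s \<in> {0..1}" for s
        using False less.prems(1) that by (intro less.hyps) auto
      then have l: "loop_pow (n + 1) (?N x (n + 1)) s \<noteq> loop_pow (n + 1) (?N y (n + 1)) s" if "s \<in> {0..1}" for s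
        by (rule loop_pow_pointwise[where R = "(\<noteq>)", OF _ that])
      have b: "\<beta> n s x \<noteq> \<beta> n s y" if "s \<in> {0..1}" for s
      proof -
        have "\<beta> n s \<in> F_omega" using is_braidD(2)[OF \<beta>[OF less.prems(1)]] that by (auto simp: path_image_def)
        then show ?thesis using \<open>x \<noteq> y\<close> by (simp add: F_omega_def)
      qed
      show ?thesis unfolding N_eq[OF less.prems]
        by (rule joinpaths_pointwise[where R = "(\<noteq>)", OF b l less.prems(2)])
    qed
  qed
  define Y where "Y n t x = ?N x n t" for n t x
  have Y: "is_braid (Y n) id" if n: "n > 0" for n
  proof -
    have "path (Y n)" unfolding path_coordinatewise Y_def using N[OF n] by (auto simp: eta_contract_eq)
    moreover have "path_image (Y n) \<subseteq> F_omega"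
      using N_distinct[OF n] by (auto simp: path_image_def F_omega_def Y_def)
    moreover have "pathstart (Y n) = of_nat" "pathfinish (Y n) = of_nat"
      using N[OF n] by (auto simp: Y_def pathstart_def pathfinish_def fun_eq_iff)
    ultimately show ?thesis by (simp add: is_braid_def)
  qed
  have "braid_class (Y n) = braid_class (\<beta> n) \<otimes>\<^bsub>braid_group\<^esub> braid_class (Y (n + 1)) [^]\<^bsub>braid_group\<^esub> (n + 1)"
    if n: "n > 0" for n
  proof -
    have eq: "Y n t = (\<beta> n +++ loop_pow (n + 1) (Y (n + 1))) t" if "t \<in> {0..1}" for t
      unfolding fun_eq_iff joinpaths_coordinate loop_pow_coordinate unfolding Y_def
      using N_eq[OF n that] by blast
    have "homotopic_paths F_omega (Y n) (\<beta> n +++ loop_pow (n + 1) (Y (n + 1)))"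
      using is_braidD[OF Y[OF n]] eq by (intro homotopic_paths_eq)
    then have "braid_class (Y n) = braid_class (\<beta> n +++ loop_pow (n + 1) (Y (n + 1)))"
      by (rule braid_class_eqI)
    also have "\<dots> = braid_class (\<beta> n) \<otimes>\<^bsub>braid_group\<^esub> braid_class (loop_pow (n + 1) (Y (n + 1)))"
      using braid_class_mult[OF \<beta>[OF n] conjunct1[OF loop_pow_braid[OF Y[of "n + 1"]]], of "n + 1"]
      by (simp del: loop_pow.simps)
    also have "braid_class (loop_pow (n + 1) (Y (n + 1))) = braid_class (Y (n + 1)) [^]\<^bsub>braid_group\<^esub> (n + 1)"
      using loop_pow_braid[OF Y[of "n + 1"], of "n + 1"] by (simp del: loop_pow.simps)
    finally show ?thesis .
  qed
  then show ?thesis using Y by blast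
qed

section \<open>Summing the series\<close>

text \<open>
  Additively: if \<open>x\<^sub>n\<^sub>+\<^sub>1 - x\<^sub>n = n! b\<^sub>n\<close> and \<open>y\<^sub>n = b\<^sub>n + (n + 1) y\<^sub>n\<^sub>+\<^sub>1\<close>, then
  \<open>x\<^sub>1 + y\<^sub>1 = x\<^sub>n + n! y\<^sub>n\<close> for all \<open>n > 0\<close> by induction.
\<close>

lemma complete_mod_UlmI:
  fixes A :: "('a, 'b) monoid_scheme"
  assumes "comm_group A"
    and solve: "\<And>b :: nat \<Rightarrow> 'a. (\<And>n. n > 0 \<Longrightarrow> b n \<in> carrier A) \<Longrightarrow>
      \<exists>y. \<forall>n>0. y n \<in> carrier A \<and> y n = b n \<otimes>\<^bsub>A\<^esub> y (n + 1) [^]\<^bsub>A\<^esub> (n + 1)"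
  shows "complete_mod_Ulm A"
  unfolding complete_mod_Ulm_def
proof (intro conjI allI impI, fact)
  interpret comm_group A by fact
  fix x :: "nat \<Rightarrow> 'a"
  assume "(\<forall>n>0. x n \<in> carrier A) \<and> (\<forall>n>0. nat_divides A (fact n) (x (n + 1) \<otimes>\<^bsub>A\<^esub> inv\<^bsub>A\<^esub> x n))"
  then have x: "\<And>n. n > 0 \<Longrightarrow> x n \<in> carrier A"
    and d: "\<And>n. n > 0 \<Longrightarrow> nat_divides A (fact n) (x (n + 1) \<otimes>\<^bsub>A\<^esub> inv\<^bsub>A\<^esub> x n)" by simp_all
  have "\<forall>n. \<exists>b. n > 0 \<longrightarrow> b \<in> carrier A \<and> x (n + 1) \<otimes>\<^bsub>A\<^esub> inv\<^bsub>A\<^esub> x n = b [^]\<^bsub>A\<^esub> (fact n :: nat)"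
    using d unfolding nat_divides_def by blast
  then have "\<exists>b. \<forall>n. n > 0 \<longrightarrow> b n \<in> carrier A \<and> x (n + 1) \<otimes>\<^bsub>A\<^esub> inv\<^bsub>A\<^esub> x n = b n [^]\<^bsub>A\<^esub> (fact n :: nat)"
    by (rule choice)
  then obtain b where b: "\<And>n. n > 0 \<Longrightarrow> b n \<in> carrier A"
    "\<And>n. n > 0 \<Longrightarrow> x (n + 1) \<otimes>\<^bsub>A\<^esub> inv\<^bsub>A\<^esub> x n = b n [^]\<^bsub>A\<^esub> (fact n :: nat)"
    by blast
  obtain y where y: "\<And>n. n > 0 \<Longrightarrow> y n \<in> carrier A"
    "\<And>n. n > 0 \<Longrightarrow> y n = b n \<otimes>\<^bsub>A\<^esub> y (n + 1) [^]\<^bsub>A\<^esub> (n + 1)"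
  proof -
    have "\<exists>y. \<forall>n>0. y n \<in> carrier A \<and> y n = b n \<otimes>\<^bsub>A\<^esub> y (n + 1) [^]\<^bsub>A\<^esub> (n + 1)"
      by (rule solve) (rule b(1))
    then show ?thesis using that by blast
  qed
  have main: "x 1 \<otimes>\<^bsub>A\<^esub> y 1 = y n [^]\<^bsub>A\<^esub> (fact n :: nat) \<otimes>\<^bsub>A\<^esub> x n" if "n > 0" for n
    using that
  proof (induction n rule: nat_induct_non_zero)
    case 1
    then show ?case using x[of 1] y(1)[of 1] by (simp add: m_comm)
  next
    case (Suc n)
    note c = x[OF Suc(1)] x[of "n + 1"] b(1)[OF Suc(1)] y(1)[of "n + 1"]
    let ?z = "y (n + 1) [^]\<^bsub>A\<^esub> (fact (Suc n) :: nat)"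
    have "y n [^]\<^bsub>A\<^esub> (fact n :: nat) = b n [^]\<^bsub>A\<^esub> (fact n :: nat) \<otimes>\<^bsub>A\<^esub> ?z"
      unfolding y(2)[OF Suc(1)] using c
      by (simp add: nat_pow_distrib nat_pow_pow nat_pow_mult add.commute del: nat_pow_Suc)
    then have "x 1 \<otimes>\<^bsub>A\<^esub> y 1 = (x (n + 1) \<otimes>\<^bsub>A\<^esub> inv\<^bsub>A\<^esub> x n) \<otimes>\<^bsub>A\<^esub> ?z \<otimes>\<^bsub>A\<^esub> x n"
      using Suc.IH b(2)[OF Suc(1)] by simp
    also have "\<dots> = (?z \<otimes>\<^bsub>A\<^esub> (x (n + 1) \<otimes>\<^bsub>A\<^esub> inv\<^bsub>A\<^esub> x n)) \<otimes>\<^bsub>A\<^esub> x n"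
      using c by (subst m_comm) simp_all
    also have "\<dots> = ?z \<otimes>\<^bsub>A\<^esub> x (n + 1)"
      using c by (simp add: m_assoc)
    finally show ?case by simp
  qed
  show "\<exists>z\<in>carrier A. \<forall>n>0. nat_divides A (fact n) (z \<otimes>\<^bsub>A\<^esub> inv\<^bsub>A\<^esub> x n)"
  proof (intro bexI allI impI)
    show "x 1 \<otimes>\<^bsub>A\<^esub> y 1 \<in> carrier A" using x[of 1] y(1)[of 1] by simp
    fix n :: nat assume "n > 0"
    then have "x 1 \<otimes>\<^bsub>A\<^esub> y 1 \<otimes>\<^bsub>A\<^esub> inv\<^bsub>A\<^esub> x n = y n [^]\<^bsub>A\<^esub> (fact n :: nat)"
      unfolding main[OF \<open>n > 0\<close>] using x[of n] y(1)[of n] by (simp add: m_assoc)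
    then show "nat_divides A (fact n) (x 1 \<otimes>\<^bsub>A\<^esub> y 1 \<otimes>\<^bsub>A\<^esub> inv\<^bsub>A\<^esub> x n)"
      unfolding nat_divides_def using y(1)[OF \<open>n > 0\<close>] by blast
  qed
qed

theorem theorem2p8:
  shows "complete_mod_Ulm (braid_group Mod derived braid_group (carrier braid_group))"
proof (rule complete_mod_UlmI)
  let ?D = "derived braid_group (carrier braid_group)"
  let ?A = "braid_group Mod ?D"
  show "comm_group ?A" by (rule B.derived_quot_is_comm_group)
  interpret D: normal ?D braid_group by (rule B.derived_self_is_normal)
  define \<pi> where "\<pi> X = ?D #>\<^bsub>braid_group\<^esub> X" for X
  interpret \<pi>: group_hom braid_group ?A \<pi>
    by (intro group_hom.intro group_hom_axioms.intro B.is_group D.factorgroup_is_group)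
       (simp only: \<pi>_def[abs_def] D.r_coset_hom_Mod)
  fix b :: "nat \<Rightarrow> (real \<Rightarrow> nat \<Rightarrow> complex) set set"
  assume b: "\<And>n. n > 0 \<Longrightarrow> b n \<in> carrier ?A"
  have "\<exists>\<beta>. is_braid \<beta> id \<and> (\<forall>t\<in>{0..1}. \<forall>i<n. \<beta> t i = of_nat i) \<and> b n = \<pi> (braid_class \<beta>)" if n: "n > 0" for n
  proof -
    obtain X where X: "X \<in> carrier braid_group" "b n = \<pi> X"
      using b[OF n] unfolding carrier_FactGroup \<pi>_def by (rule imageE)
    obtain \<beta> d where \<beta>: "is_braid \<beta> id" "\<forall>t\<in>{0..1}. \<forall>i<n. \<beta> t i = of_nat i"
      and d: "d \<in> ?D" "X = braid_class \<beta> \<otimes>\<^bsub>braid_group\<^esub> d"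
      using class_represented_by_pure_braid_fixing_first_strands[OF X(1) n] by blast
    have c: "braid_class \<beta> \<in> carrier braid_group" using \<beta>(1) braid_group_carrier by blast
    have "\<pi> d = \<one>\<^bsub>?A\<^esub>" unfolding \<pi>_def one_FactGroup by (rule D.rcos_const[OF B.is_group d(1)])
    moreover have "\<pi> X = \<pi> (braid_class \<beta>) \<otimes>\<^bsub>?A\<^esub> \<pi> d"
      unfolding d(2) using c D.mem_carrier[OF d(1)] by (rule \<pi>.hom_mult)
    ultimately have "\<pi> X = \<pi> (braid_class \<beta>)"
      using \<pi>.H.r_one[OF \<pi>.hom_closed[OF c]] by simp
    then show ?thesis using \<beta> X(2) by blast
  qed
  then have "\<forall>n. \<exists>\<beta>. n > 0 \<longrightarrow> is_braid \<beta> id \<and> (\<forall>t\<in>{0..1}. \<forall>i<n. \<beta> t i = of_nat i) \<and> b n = \<pi> (braid_class \<beta>)"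
    by simp
  then obtain \<beta> where \<beta>': "\<forall>n. n > 0 \<longrightarrow> is_braid (\<beta> n) id
      \<and> (\<forall>t\<in>{0..1}. \<forall>i<n. \<beta> n t i = of_nat i) \<and> b n = \<pi> (braid_class (\<beta> n))"
    by (rule choice[THEN exE])
  then have \<beta>: "\<And>n. n > 0 \<Longrightarrow> is_braid (\<beta> n) id"
    "\<And>n t i. n > 0 \<Longrightarrow> t \<in> {0..1} \<Longrightarrow> i < n \<Longrightarrow> \<beta> n t i = of_nat i"
    "\<And>n. n > 0 \<Longrightarrow> b n = \<pi> (braid_class (\<beta> n))"
    by simp_all
  have "\<exists>Y. \<forall>n>0. is_braid (Y n) id \<and> braid_class (Y n) =
      braid_class (\<beta> n) \<otimes>\<^bsub>braid_group\<^esub> braid_class (Y (n + 1)) [^]\<^bsub>braid_group\<^esub> (n + 1)"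
    by (rule nested_braid_exists) (fact \<beta>(1), fact \<beta>(2))
  then obtain Y where Y': "\<forall>n>0. is_braid (Y n) id \<and> braid_class (Y n) =
      braid_class (\<beta> n) \<otimes>\<^bsub>braid_group\<^esub> braid_class (Y (n + 1)) [^]\<^bsub>braid_group\<^esub> (n + 1)"
    by (rule exE)
  then have Y: "\<And>n. n > 0 \<Longrightarrow> is_braid (Y n) id" "\<And>n. n > 0 \<Longrightarrow> braid_class (Y n) =
      braid_class (\<beta> n) \<otimes>\<^bsub>braid_group\<^esub> braid_class (Y (n + 1)) [^]\<^bsub>braid_group\<^esub> (n + 1)"
    by blast+
  have c: "braid_class (\<beta> n) \<in> carrier braid_group" "braid_class (Y n) \<in> carrier braid_group" if "n > 0" for n
    using \<beta>(1)[OF that] Y(1)[OF that] braid_group_carrier by blast+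
  show "\<exists>y. \<forall>n>0. y n \<in> carrier ?A \<and> y n = b n \<otimes>\<^bsub>?A\<^esub> y (n + 1) [^]\<^bsub>?A\<^esub> (n + 1)"
  proof (intro exI[of _ "\<lambda>n. \<pi> (braid_class (Y n))"] allI impI conjI)
    fix n :: nat assume n: "n > 0"
    show "\<pi> (braid_class (Y n)) \<in> carrier ?A" using c(2)[OF n] by (rule \<pi>.hom_closed)
    have "\<pi> (braid_class (Y n)) = \<pi> (braid_class (\<beta> n)) \<otimes>\<^bsub>?A\<^esub> \<pi> (braid_class (Y (n + 1)) [^]\<^bsub>braid_group\<^esub> (n + 1))"
      unfolding Y(2)[OF n] using c(1)[OF n] c(2)[of "n + 1"] by (intro \<pi>.hom_mult B.nat_pow_closed) simp_all
    also have "\<dots> = b n \<otimes>\<^bsub>?A\<^esub> \<pi> (braid_class (Y (n + 1))) [^]\<^bsub>?A\<^esub> (n + 1)"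
      unfolding \<beta>(3)[OF n] by (subst \<pi>.hom_nat_pow) (simp_all add: c)
    finally show "\<pi> (braid_class (Y n)) = b n \<otimes>\<^bsub>?A\<^esub> \<pi> (braid_class (Y (n + 1))) [^]\<^bsub>?A\<^esub> (n + 1)" .
  qed
qed

end
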